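(* Let $D$ be a domain in $\mathbb{C}$ and let $u:D\to[-\infty,\infty)$ be a subharmonic function which is not identically equal to $-\infty$. If $K\subseteq D$ is an open set that is relatively compact in $D$, then there exists a harmonic function $h$ on $K$ such that $$u=p_\mu+h\quad\text{on }K,$$ where $\mu$ is the finite Borel measure determined by $2\pi\mu=\Delta u|_K$.
   Context: A domain is a nonempty connected open set. $m$ is Lebesgue measure on $\mathbb{C}\cong\mathbb{R}^2$. A function $h:K\to\mathbb{R}$ on an open set is harmonic if it is $C^2$ and $h_{xx}+h_{yy}=0$. A function $u:D\to[-\infty,\infty)$ on an open set $D\subseteq\mathbb{C}$ is subharmonic if it is upper-semicontinuous and for every $w\in D$ there is $\rho>0$ such that $u(w)\le \frac{1}{2\pi}\int_0^{2\pi}u(w+re^{it})\,dt$ for $0\le r<\rho$. For $u\not\equiv-\infty$ subharmonic on a domain $D$ (such $u$ is locally integrable), $\Delta u$ denotes the unique Radon measure (non-negative, finite on compact sets) on $D$ with $\int_D\phi\,\Delta u=\int_D u\,\Delta\phi\,dm$ for all $\phi\in C_c^\infty(D)$; $\Delta u|_K$ is its restriction to $K$, regarded as a measure on $\mathbb{C}$. For a finite Borel measure $\mu$ on $\mathbb{C}$ with compact support, the logarithmic potential is $p_\mu(z)=\int_{\mathbb{C}}\log|z-w|\,d\mu(w)$, with values in $[-\infty,\infty)$. *)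

theory Defs
  imports "HOL-Analysis.Analysis"
begin

text \<open>
  The integral of an extended-real function, as the difference of the integrals of its positive and
  negative parts (\<^const>\<open>e2ennreal\<close> truncates negative values to 0). All integrands below have a
  positive or a negative part of finite integral whenever the integral is meant to exist;
  \<open>\<infinity> - \<infinity>\<close> is \<open>\<infinity>\<close> in \<^typ>\<open>ereal\<close>, so an undefined integral never equals a real number.
\<close>

definition ereal_integral :: "'a measure \<Rightarrow> ('a \<Rightarrow> ereal) \<Rightarrow> ereal" where
  "ereal_integral M f =
     enn2ereal (\<integral>\<^sup>+ x. e2ennreal (f x) \<partial>M) - enn2ereal (\<integral>\<^sup>+ x. e2ennreal (- f x) \<partial>M)"

definition domain_in_C :: "complex set \<Rightarrow> bool" where
  "domain_in_C D \<longleftrightarrow> D \<noteq> {} \<and> open D \<and> connected D"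

text \<open>\<open>partial 1 f\<close> and \<open>partial \<i> f\<close> are the partial derivatives \<open>f\<^sub>x\<close> and \<open>f\<^sub>y\<close>.\<close>

definition partial :: "complex \<Rightarrow> (complex \<Rightarrow> real) \<Rightarrow> complex \<Rightarrow> real" where
  "partial v f z = frechet_derivative f (at z) v"

text \<open>\<open>C_k_on k S f\<close> is meant for open \<open>S\<close> only.\<close>

primrec C_k_on :: "nat \<Rightarrow> complex set \<Rightarrow> (complex \<Rightarrow> real) \<Rightarrow> bool" where
  "C_k_on 0 S f \<longleftrightarrow> continuous_on S f"
| "C_k_on (Suc k) S f \<longleftrightarrow>
     (\<forall>z\<in>S. f differentiable (at z)) \<and> C_k_on k S (partial 1 f) \<and> C_k_on k S (partial \<i> f)"

definition laplacian :: "(complex \<Rightarrow> real) \<Rightarrow> complex \<Rightarrow> real" where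
  "laplacian f z = partial 1 (partial 1 f) z + partial \<i> (partial \<i> f) z"

definition harmonic_on :: "complex set \<Rightarrow> (complex \<Rightarrow> real) \<Rightarrow> bool" where
  "harmonic_on K h \<longleftrightarrow> open K \<and> C_k_on 2 K h \<and> (\<forall>z\<in>K. laplacian h z = 0)"

definition usc_on :: "complex set \<Rightarrow> (complex \<Rightarrow> ereal) \<Rightarrow> bool" where
  "usc_on D u \<longleftrightarrow> (\<forall>c. openin (top_of_set D) {z \<in> D. u z < c})"

definition circle_mean :: "(complex \<Rightarrow> ereal) \<Rightarrow> complex \<Rightarrow> real \<Rightarrow> ereal" where
  "circle_mean u w r =
     ereal (1 / (2 * pi)) *
     ereal_integral (restrict_space lborel {0..2 * pi}) (\<lambda>t. u (w + of_real r * cis t))"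

definition subharmonic_on :: "complex set \<Rightarrow> (complex \<Rightarrow> ereal) \<Rightarrow> bool" where
  "subharmonic_on D u \<longleftrightarrow>
     open D \<and> (\<forall>z\<in>D. u z \<noteq> \<infinity>) \<and> usc_on D u \<and>
     (\<forall>w\<in>D. \<exists>\<rho>>0. ball w \<rho> \<subseteq> D \<and> (\<forall>r. 0 \<le> r \<and> r < \<rho> \<longrightarrow> u w \<le> circle_mean u w r))"

text \<open>\<open>C\<^sub>c\<^sup>\<infinity>(D)\<close>; its elements are taken to be extended by 0 to the whole plane.\<close>

definition test_function :: "complex set \<Rightarrow> (complex \<Rightarrow> real) \<Rightarrow> bool" where
  "test_function D \<phi> \<longleftrightarrow>
     (\<forall>k. C_k_on k UNIV \<phi>) \<and> compact (closure {z. \<phi> z \<noteq> 0}) \<and> closure {z. \<phi> z \<noteq> 0} \<subseteq> D"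

definition radon_measure_on :: "complex set \<Rightarrow> complex measure \<Rightarrow> bool" where
  "radon_measure_on D \<nu> \<longleftrightarrow>
     sets \<nu> = sets (restrict_space borel D) \<and>
     (\<forall>C. compact C \<and> C \<subseteq> D \<longrightarrow> emeasure \<nu> C < \<infinity>)"

text \<open>\<open>\<nu> = \<Delta>u\<close>: the defining property that characterises the generalised Laplacian of \<open>u\<close>.\<close>

definition is_generalised_laplacian ::
    "complex set \<Rightarrow> (complex \<Rightarrow> ereal) \<Rightarrow> complex measure \<Rightarrow> bool" where
  "is_generalised_laplacian D u \<nu> \<longleftrightarrow>
     radon_measure_on D \<nu> \<and>
     (\<forall>\<phi>. test_function D \<phi> \<longrightarrow>
        ereal (\<integral>z. \<phi> z \<partial>\<nu>) =
        ereal_integral (restrict_space lborel D) (\<lambda>z. u z * ereal (laplacian \<phi> z)))"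

text \<open>The restriction of \<open>\<nu>\<close> to \<open>K\<close>, pushed forward to a Borel measure on the plane.\<close>

definition restrict_measure :: "complex measure \<Rightarrow> complex set \<Rightarrow> complex measure" where
  "restrict_measure \<nu> K = distr (restrict_space \<nu> K) borel (\<lambda>z. z)"

definition log_potential :: "complex measure \<Rightarrow> complex \<Rightarrow> ereal" where
  "log_potential \<mu> z =
     ereal_integral \<mu> (\<lambda>w. if z = w then -\<infinity> else ereal (ln (cmod (z - w))))"

end

theory Submission
  imports Defs
begin

text \<open>
  Let \<open>L\<^sub>\<delta>\<close> be a smooth radial function that equals \<open>log \<bar>z\<bar>\<close> off the disc of radius \<open>\<delta>\<close>, decreases to
  \<open>log \<bar>z\<bar>\<close> as \<open>\<delta> \<rightarrow> 0\<close>, and has Laplacian \<open>2 \<pi> \<chi>\<^sub>\<delta>\<close> with \<open>\<chi>\<^sub>\<delta> \<ge> 0\<close> of mass 1. Testing \<open>\<Delta>u\<close> against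
  \<open>L\<^sub>\<epsilon>(\<cdot> - w) - L\<^sub>\<delta>(\<cdot> - w)\<close> compares the means \<open>u * \<chi>\<^sub>\<epsilon>\<close> and \<open>u * \<chi>\<^sub>\<delta>\<close> at \<open>w\<close>. Since \<open>u * \<chi>\<^sub>\<epsilon> \<rightarrow> u\<close> pointwise,
  \<open>\<epsilon> \<rightarrow> 0\<close> and monotone convergence give, at every point of \<open>K\<close> and with \<open>2 \<pi> \<sigma> = \<Delta>u\<close>,
  \<open>u(w) = (u * \<chi>\<^sub>\<delta>)(w) - \<integral> (L\<^sub>\<delta> - log)(z - w) d\<sigma>(z)\<close>. The part of \<open>\<integral> log \<bar>z - w\<bar> d\<sigma>(z)\<close> over \<open>K\<close> is the
  potential; the remaining terms form \<open>h\<close>, whose Laplacian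
  \<open>(u * \<Delta>\<chi>\<^sub>\<delta>)(w) - \<integral> \<chi>\<^sub>\<delta>(z - w) \<Delta>u(z)\<close> vanishes because \<open>\<chi>\<^sub>\<delta>(\<cdot> - w)\<close> is itself a test function.
  Thus Weyl's lemma is not needed.
\<close>

section \<open>Calculus of \<open>C\<^sup>k\<close> functions\<close>

text \<open>The obstacle is the value -\<infinity>: the formula is wanted at every point of
  \<open>K\<close>, so an infinite quantity may never be cancelled. Each formula is therefore kept
  as a real number minus an \<open>ennreal\<close> integral. The integral of
  \<open>L_\<delta> - log\<close> over \<open>K\<close>, which is infinite exactly where u is
  -\<infinity>, enters u and the potential with the same sign, and all that goes into h is finite.

  Local integrability of u is drawn from the defining property of \<Delta>u: an integral of u
  against \<Delta>\<phi> that equals a real number converges absolutely, so near a given point one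
  \<phi> with \<Delta>\<phi> bounded away from 0 suffices. Since \<open>\<chi>_\<delta>\<close> is
  positive exactly between the radii \<delta>/2 and \<delta>, \<open>\<chi>_(\<delta>/2)\<close> and
  \<open>\<chi>_\<delta>\<close> are nowhere both positive, and the Laplacian of
  \<open>L_(\<delta>/2) - L_\<delta>\<close> provides such a \<phi>.

  By compactness of the closure of \<open>K\<close> one radius \<delta> serves all its points. Hence
  the terms of h are integrals against fixed kernels in which w enters by translation only.\<close>

lemma partial_eq_derivative: "(f has_derivative f') (at z) \<Longrightarrow> partial v f z = f' v"
  using frechet_derivative_at[of f f' z] by (simp add: partial_def)

lemma has_derivative_partial:
  "f differentiable (at z) \<Longrightarrow> (f has_derivative (\<lambda>v. partial v f z)) (at z)"
  unfolding partial_def using frechet_derivative_works by auto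

lemma partial_Re_Im:
  assumes "f differentiable (at z)"
  shows "partial v f z = Re v * partial 1 f z + Im v * partial \<i> f z"
proof -
  interpret bounded_linear "\<lambda>v. partial v f z"
    using has_derivative_partial[OF assms] by (rule has_derivative_bounded_linear)
  have "v = Re v *\<^sub>R 1 + Im v *\<^sub>R \<i>"
    by (simp add: complex_eq_iff)
  then have "partial v f z = partial (Re v *\<^sub>R 1 + Im v *\<^sub>R \<i>) f z"
    by simp
  then show ?thesis
    by (simp only: add scaleR real_scaleR_def)
qed

text \<open>\<open>frechet_derivative\<close> is a choice. Functions that agree near
  \<open>z\<close> have the same derivatives at \<open>z\<close>, so the chosen values agree even
  where no derivative exists; \<open>C_k_on_cong\<close> relies on this.\<close>

lemma partial_cong:
  assumes "open S" "z \<in> S" "\<And>x. x \<in> S \<Longrightarrow> f x = g x"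
  shows "partial v f z = partial v g z"
proof -
  have "(f has_derivative d) (at z) \<longleftrightarrow> (g has_derivative d) (at z)" for d
    using assms has_derivative_transform_within_open by metis
  then show ?thesis
    by (simp add: partial_def frechet_derivative_def)
qed

lemma C_k_on_cong:
  assumes "open S" "\<And>z. z \<in> S \<Longrightarrow> f z = g z"
  shows "C_k_on k S f \<longleftrightarrow> C_k_on k S g"
  using assms(2)
proof (induction k arbitrary: f g)
  case 0
  then show ?case by (simp cong: continuous_on_cong)
next
  case (Suc k)
  have "f differentiable (at z) \<longleftrightarrow> g differentiable (at z)" if "z \<in> S" for z
    unfolding differentiable_def
    using has_derivative_transform_within_open[OF _ assms(1) that] Suc.prems by metis
  moreover have "C_k_on k S (partial v f) \<longleftrightarrow> C_k_on k S (partial v g)" for v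
    by (rule Suc.IH) (use partial_cong[OF assms(1)] Suc.prems in blast)
  ultimately show ?case by auto
qed

lemma C_k_on_SucD: "C_k_on (Suc k) S f \<Longrightarrow> C_k_on k S f"
proof (induction k arbitrary: f)
  case 0
  then have "f differentiable_on S"
    by (auto simp: differentiable_on_def intro: differentiable_at_withinI)
  then show ?case
    by (simp add: differentiable_imp_continuous_on)
next
  case (Suc k)
  have "\<forall>z\<in>S. f differentiable (at z)"
    "C_k_on (Suc k) S (partial 1 f)" "C_k_on (Suc k) S (partial \<i> f)"
    using Suc.prems by simp_all
  from this(1) Suc.IH[OF this(2)] Suc.IH[OF this(3)] show ?case
    by simp
qed

lemma C_k_on_imp_continuous_on: "C_k_on k S f \<Longrightarrow> continuous_on S f"
proof (induction k)
  case (Suc k)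
  then show ?case by (blast dest: C_k_on_SucD)
qed simp

lemma C_k_on_subset: "C_k_on k S f \<Longrightarrow> T \<subseteq> S \<Longrightarrow> C_k_on k T f"
  by (induction k arbitrary: f) (auto intro: continuous_on_subset)

text \<open>Serves for functions that have different smooth expressions in different regions: the
  profile derivative \<open>g\<close> composed with \<open>sq_dist\<close>, and the harmonic part
  \<open>h\<close>.\<close>

lemma C_k_on_locally:
  assumes "\<And>z. z \<in> S \<Longrightarrow> \<exists>U. open U \<and> z \<in> U \<and> C_k_on k U f"
  shows "C_k_on k S f"
  using assms
proof (induction k arbitrary: f)
  case 0
  then show ?case
    by (metis C_k_on.simps(1) continuous_at_imp_continuous_on continuous_on_eq_continuous_at)
next
  case (Suc k)
  have "C_k_on k S (partial v f)" if "v = 1 \<or> v = \<i>" for v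
    by (rule Suc.IH) (use Suc.prems that in \<open>fastforce\<close>)
  moreover have "\<forall>z\<in>S. f differentiable (at z)"
    using Suc.prems by fastforce
  ultimately show ?case by simp
qed

lemma C_k_on_const: "C_k_on k S (\<lambda>_. c)"
proof (induction k arbitrary: c)
  case (Suc k)
  have "partial v (\<lambda>_. c) = (\<lambda>_. 0)" for v
    by (rule ext, rule partial_eq_derivative[where f' = "\<lambda>_. 0", simplified]) simp
  then show ?case using Suc by simp
qed simp

lemma partial_add:
  assumes "f differentiable (at z)" "g differentiable (at z)"
  shows "partial v (\<lambda>z. f z + g z) z = partial v f z + partial v g z"
  by (rule partial_eq_derivative, rule has_derivative_add; rule has_derivative_partial; fact)

lemma partial_mult:
  assumes "f differentiable (at z)" "g differentiable (at z)"
  shows "partial v (\<lambda>z. f z * g z) z = f z * partial v g z + partial v f z * g z"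
  by (rule partial_eq_derivative, rule has_derivative_mult; rule has_derivative_partial; fact)

lemma C_k_on_add:
  assumes "open S" "C_k_on k S f" "C_k_on k S g"
  shows "C_k_on k S (\<lambda>z. f z + g z)"
  using assms(2,3)
proof (induction k arbitrary: f g)
  case 0
  then show ?case by (auto intro: continuous_on_add)
next
  case (Suc k)
  have "C_k_on k S (partial v (\<lambda>z. f z + g z))"
    if "C_k_on k S (partial v f)" "C_k_on k S (partial v g)" for v
    using C_k_on_cong[OF assms(1), THEN iffD2, OF partial_add Suc.IH[OF that]] Suc.prems by auto
  then show ?case using Suc.prems by (auto intro: differentiable_add)
qed

lemma C_k_on_mult:
  assumes "open S" "C_k_on k S f" "C_k_on k S g"
  shows "C_k_on k S (\<lambda>z. f z * g z)"
  using assms(2,3)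
proof (induction k arbitrary: f g)
  case 0
  then show ?case by (auto intro: continuous_on_mult)
next
  case (Suc k)
  have fg: "C_k_on k S f" "C_k_on k S g"
    using Suc.prems by (blast dest: C_k_on_SucD)+
  have "C_k_on k S (partial v (\<lambda>z. f z * g z))"
    if "C_k_on k S (partial v f)" "C_k_on k S (partial v g)" for v
    using C_k_on_cong[OF assms(1), THEN iffD2, OF partial_mult
        C_k_on_add[OF assms(1) Suc.IH[OF fg(1) that(2)] Suc.IH[OF that(1) fg(2)]]] Suc.prems by auto
  then show ?case using Suc.prems by (auto intro: differentiable_mult)
qed

lemma C_k_on_cmult: "open S \<Longrightarrow> C_k_on k S f \<Longrightarrow> C_k_on k S (\<lambda>z. c * f z)"
  by (intro C_k_on_mult C_k_on_const)

lemma C_k_on_diff: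
  assumes "open S" "C_k_on k S f" "C_k_on k S g"
  shows "C_k_on k S (\<lambda>z. f z - g z)"
  using C_k_on_add[OF assms(1,2) C_k_on_cmult[OF assms(1,3), of "-1"]] by simp

lemma partial_chain:
  assumes "q differentiable (at z)" "(G has_real_derivative G') (at (q z))"
  shows "partial v (\<lambda>z. G (q z)) z = G' * partial v q z"
  by (rule partial_eq_derivative)
     (use has_derivative_compose[OF has_derivative_partial[OF assms(1)]
       assms(2)[unfolded has_field_derivative_def]] in simp)

text \<open>Smoothness of the outer derivative is expressed only through the composite
  \<open>g (q z)\<close> on the plane. An induction that gains one order per step then covers
  \<open>inverse\<close>, \<open>flat_exp\<close> and iterated antiderivatives.\<close>

lemma C_k_on_chain_Suc:
  assumes "open S" "\<And>z. z \<in> S \<Longrightarrow> (G has_real_derivative g (q z)) (at (q z))"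
    "C_k_on k S (\<lambda>z. g (q z))" "C_k_on (Suc k) S q"
  shows "C_k_on (Suc k) S (\<lambda>z. G (q z))"
proof -
  have q: "q differentiable (at z)" if "z \<in> S" for z
    using assms(4) that by simp
  have "C_k_on k S (partial v (\<lambda>z. G (q z)))" if "C_k_on k S (partial v q)" for v
    using C_k_on_cong[OF assms(1), THEN iffD2, OF partial_chain[OF q assms(2)]
        C_k_on_mult[OF assms(1,3) that]] by auto
  moreover have "(\<lambda>z. G (q z)) differentiable (at z)" if "z \<in> S" for z
    using has_derivative_compose[OF has_derivative_partial[OF q[OF that]]
      assms(2)[OF that, unfolded has_field_derivative_def]] by (auto simp: differentiable_def)
  ultimately show ?thesis using assms(4) by auto
qed

lemma C_k_on_inverse:
  assumes "open S" "C_k_on k S f" "\<And>z. z \<in> S \<Longrightarrow> f z \<noteq> 0"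
  shows "C_k_on k S (\<lambda>z. inverse (f z))"
  using assms(2)
proof (induction k)
  case 0
  then show ?case using assms(3) by (auto intro: continuous_on_inverse)
next
  case (Suc k)
  have "C_k_on k S f"
    using Suc.prems by (rule C_k_on_SucD)
  from Suc.IH[OF this] have "C_k_on k S (\<lambda>z. (-1) * (inverse (f z) * inverse (f z)))"
    by (intro C_k_on_cmult C_k_on_mult assms)
  moreover have "(inverse has_real_derivative (-1) * (inverse (f z) * inverse (f z))) (at (f z))"
    if "z \<in> S" for z
    using DERIV_inverse[OF assms(3)[OF that]] by (simp add: power2_eq_square numeral_2_eq_2)
  ultimately show ?case
    using C_k_on_chain_Suc[where G = inverse and q = f and S = S and k = k
        and g = "\<lambda>x. (-1) * (inverse x * inverse x)"] assms(1) Suc.prems by blast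
qed

lemma C_k_on_inner: "C_k_on k UNIV (\<lambda>z::complex. (z - w) \<bullet> e)"
proof (cases k)
  case (Suc m)
  have D: "((\<lambda>z. (z - w) \<bullet> e) has_derivative (\<lambda>v. v \<bullet> e)) (at z)" for z
    by (auto intro!: derivative_eq_intros)
  have "partial v (\<lambda>z. (z - w) \<bullet> e) = (\<lambda>_. v \<bullet> e)" for v
    by (rule ext) (rule partial_eq_derivative[OF D])
  then show ?thesis
    using Suc D by (auto simp: C_k_on_const differentiable_def)
qed (auto intro!: continuous_intros)

section \<open>Uniform Taylor bounds on discs and differentiation under the integral sign\<close>

lemma C_k_on_lipschitz:
  assumes "C_k_on 1 UNIV f"
  obtains B where "B \<ge> 0"
    "\<And>x y. x \<in> cball 0 R \<Longrightarrow> y \<in> cball 0 R \<Longrightarrow> \<bar>f y - f x\<bar> \<le> B * cmod (y - x)"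
proof -
  have d: "f differentiable (at z)" for z
    using assms by auto
  have c: "continuous_on UNIV (partial 1 f)" "continuous_on UNIV (partial \<i> f)"
    using assms by auto
  have "bounded (partial v f ` cball 0 R)" if "continuous_on UNIV (partial v f)" for v
    using that by (intro compact_imp_bounded compact_continuous_image) (auto intro: continuous_on_subset)
  from this[OF c(1)] this[OF c(2)] obtain B1 B2 where
    B: "\<And>x. x \<in> cball 0 R \<Longrightarrow> \<bar>partial 1 f x\<bar> \<le> B1" "\<And>x. x \<in> cball 0 R \<Longrightarrow> \<bar>partial \<i> f x\<bar> \<le> B2"
    unfolding bounded_iff by (metis imageI real_norm_def)
  \<comment> \<open>For \<open>R < 0\<close> the ball is empty and \<open>B1\<close>,
    \<open>B2\<close> may be negative; the absolute values keep the constant nonnegative.\<close>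
  have ob: "onorm (\<lambda>v. partial v f z) \<le> \<bar>B1\<bar> + \<bar>B2\<bar>" if "z \<in> cball 0 R" for z
  proof (rule onorm_bound)
    fix v
    have "\<bar>partial 1 f z\<bar> \<le> \<bar>B1\<bar>" "\<bar>partial \<i> f z\<bar> \<le> \<bar>B2\<bar>"
      using B[OF that] by linarith+
    then have "\<bar>Re v * partial 1 f z\<bar> + \<bar>Im v * partial \<i> f z\<bar> \<le> cmod v * \<bar>B1\<bar> + cmod v * \<bar>B2\<bar>"
      unfolding abs_mult by (intro add_mono mult_mono abs_Re_le_cmod abs_Im_le_cmod) simp_all
    then have "\<bar>partial v f z\<bar> \<le> cmod v * \<bar>B1\<bar> + cmod v * \<bar>B2\<bar>"
      unfolding partial_Re_Im[OF d, of v z] by linarith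
    then show "norm (partial v f z) \<le> (\<bar>B1\<bar> + \<bar>B2\<bar>) * norm v"
      by (simp add: algebra_simps)
  qed simp
  have "\<bar>f y - f x\<bar> \<le> (\<bar>B1\<bar> + \<bar>B2\<bar>) * cmod (y - x)" if "x \<in> cball 0 R" "y \<in> cball 0 R" for x y
    unfolding real_norm_def[symmetric]
    by (rule differentiable_bound[where S = "cball 0 R" and f' = "\<lambda>z v. partial v f z"])
       (use ob that has_derivative_at_withinI[OF has_derivative_partial[OF d]] in auto)
  then show thesis
    using that[of "\<bar>B1\<bar> + \<bar>B2\<bar>"] by auto
qed

text \<open>The partials are Lipschitz on the ball, so along the segment from \<open>x\<close> to
  \<open>y\<close> the derivative changes by a multiple of \<open>cmod (y - x)\<close>; linearising
  at \<open>x\<close> contributes a second such factor. The constant does not depend on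
  \<open>x\<close>, which is what makes the bound integrable later.\<close>

lemma C_k_on_quadratic_remainder:
  assumes "C_k_on 2 UNIV f"
  obtains B where "B \<ge> 0"
    "\<And>x y. x \<in> cball 0 R \<Longrightarrow> y \<in> cball 0 R \<Longrightarrow>
       \<bar>f y - f x - partial (y - x) f x\<bar> \<le> B * cmod (y - x) ^ 2"
proof -
  have d: "f differentiable (at z)" for z
    using assms by (auto simp: numeral_2_eq_2)
  have c: "C_k_on 1 UNIV (partial 1 f)" "C_k_on 1 UNIV (partial \<i> f)"
    using assms by (auto simp: numeral_2_eq_2)
  obtain B1 where B1: "B1 \<ge> 0" "\<And>x y. x \<in> cball 0 R \<Longrightarrow> y \<in> cball 0 R \<Longrightarrow>
      \<bar>partial 1 f y - partial 1 f x\<bar> \<le> B1 * cmod (y - x)"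
    using C_k_on_lipschitz[OF c(1)] by metis
  obtain B2 where B2: "B2 \<ge> 0" "\<And>x y. x \<in> cball 0 R \<Longrightarrow> y \<in> cball 0 R \<Longrightarrow>
      \<bar>partial \<i> f y - partial \<i> f x\<bar> \<le> B2 * cmod (y - x)"
    using C_k_on_lipschitz[OF c(2)] by metis
  have "\<bar>f y - f x - partial (y - x) f x\<bar> \<le> (B1 + B2) * cmod (y - x) ^ 2"
    if xy: "x \<in> cball 0 R" "y \<in> cball 0 R" for x y
  proof -
    \<comment> \<open>The second ball turns the Lipschitz bound in \<open>cmod (z - x)\<close> into
      one in \<open>cmod (y - x)\<close>; the intersection is convex and contains both
      endpoints.\<close>
    let ?S = "cball 0 R \<inter> cball x (cmod (y - x))"
    have ob: "onorm ((\<lambda>v. partial v f z) - (\<lambda>v. partial v f x)) \<le> (B1 + B2) * cmod (y - x)"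
      if z: "z \<in> ?S" for z
    proof (rule onorm_bound)
      fix v
      have le: "B * cmod (z - x) \<le> B * cmod (y - x)" if "B \<ge> 0" for B
        using z that by (intro mult_left_mono) (auto simp: dist_norm norm_minus_commute)
      have "((\<lambda>v. partial v f z) - (\<lambda>v. partial v f x)) v =
          Re v * (partial 1 f z - partial 1 f x) + Im v * (partial \<i> f z - partial \<i> f x)"
        by (simp add: partial_Re_Im[OF d, of v] algebra_simps)
      also have "\<bar>\<dots>\<bar> \<le> cmod v * (B1 * cmod (y - x)) + cmod v * (B2 * cmod (y - x))"
      proof (intro order_trans[OF abs_triangle_ineq] add_mono)
        have "\<bar>partial 1 f z - partial 1 f x\<bar> \<le> B1 * cmod (y - x)"
          using B1(2)[OF xy(1), of z] z le[OF B1(1)] by simp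
        then show "\<bar>Re v * (partial 1 f z - partial 1 f x)\<bar> \<le> cmod v * (B1 * cmod (y - x))"
          unfolding abs_mult by (rule mult_mono[OF abs_Re_le_cmod]) simp_all
        have "\<bar>partial \<i> f z - partial \<i> f x\<bar> \<le> B2 * cmod (y - x)"
          using B2(2)[OF xy(1), of z] z le[OF B2(1)] by simp
        then show "\<bar>Im v * (partial \<i> f z - partial \<i> f x)\<bar> \<le> cmod v * (B2 * cmod (y - x))"
          unfolding abs_mult by (rule mult_mono[OF abs_Im_le_cmod]) simp_all
      qed
      finally show "norm (((\<lambda>v. partial v f z) - (\<lambda>v. partial v f x)) v)
          \<le> (B1 + B2) * cmod (y - x) * norm v"
        by (simp add: algebra_simps)
    qed (use B1 B2 in simp)
    have "x \<in> ?S" "y \<in> ?S"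
      using xy by (auto simp: dist_norm norm_minus_commute)
    then have "closed_segment x y \<subseteq> ?S"
      by (intro closed_segment_subset convex_Int convex_cball)
    moreover have "x + t *\<^sub>R (y - x) \<in> closed_segment x y" if "t \<in> {0..1}" for t
      using that by (auto simp only: in_segment atLeastAtMost_iff intro!: exI[of _ t]) (simp add: algebra_simps)
    ultimately have seg: "x + t *\<^sub>R (y - x) \<in> ?S" if "t \<in> {0..1}" for t
      using that by blast
    have "norm (f y - f x - partial (y - x) f x) \<le> norm (y - x) * ((B1 + B2) * cmod (y - x))"
      by (rule differentiable_bound_linearization[where f' = "\<lambda>z v. partial v f z" and S = ?S])
         (use seg ob \<open>x \<in> ?S\<close> has_derivative_at_withinI[OF has_derivative_partial[OF d]] in blast)+
    then show ?thesis
      by (simp add: power2_eq_square algebra_simps)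
  qed
  then show thesis
    using that[of "B1 + B2"] B1 B2 by auto
qed

text \<open>The bounded support is put on \<open>v\<close> and not on \<open>\<kappa>\<close>, which
  admits the logarithmic kernels. Only values of \<open>\<kappa>\<close> on the ball of radius
  \<open>cmod w + R\<close> matter. The measure is kept general because both \<open>lborel\<close>
  and \<open>\<nu>\<close>, whose space is only \<open>D\<close>, are used.\<close>

lemma integrable_kernel:
  fixes v :: "complex \<Rightarrow> real"
  assumes \<kappa>: "continuous_on UNIV \<kappa>" and v: "integrable \<sigma> v"
    and R: "{z. v z \<noteq> 0} \<subseteq> cball 0 R" and id: "(\<lambda>z. z) \<in> borel_measurable \<sigma>"
  shows "integrable \<sigma> (\<lambda>z. v z * (\<kappa> (w - z) :: real))"
proof -
  have "bounded (\<kappa> ` cball 0 (cmod w + R))"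
    using \<kappa> by (intro compact_imp_bounded compact_continuous_image) (auto intro: continuous_on_subset)
  then obtain B where B: "\<And>x. x \<in> cball 0 (cmod w + R) \<Longrightarrow> \<bar>\<kappa> x\<bar> \<le> B"
    unfolding bounded_iff by (metis imageI real_norm_def)
  have k: "\<kappa> \<in> borel_measurable borel"
    using \<kappa> by (rule borel_measurable_continuous_onI)
  have m: "(\<lambda>z. \<kappa> (w - z)) \<in> borel_measurable \<sigma>"
    by (rule measurable_compose[OF _ k]) (use id in measurable)
  have "\<bar>v z * \<kappa> (w - z)\<bar> \<le> \<bar>v z * B\<bar>" for z
  proof (cases "v z = 0")
    case False
    then have "w - z \<in> cball 0 (cmod w + R)"
      using R False norm_triangle_ineq4[of w z] by fastforce
    from B[OF this] show ?thesis
      by (auto simp: abs_mult intro!: mult_left_mono)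
  qed simp
  then have bd: "AE z in \<sigma>. norm (v z * \<kappa> (w - z)) \<le> norm (v z * B)"
    by simp
  have "integrable \<sigma> (\<lambda>z. v z * B)"
    using v by simp
  moreover have "(\<lambda>z. v z * \<kappa> (w - z)) \<in> borel_measurable \<sigma>"
    by (rule borel_measurable_times[OF borel_measurable_integrable[OF v] m])
  ultimately show ?thesis
    using bd by (rule Bochner_Integration.integrable_bound)
qed

text \<open>The quadratic remainder bound holds with one constant for all \<open>z\<close> in the
  support of \<open>v\<close>, so it can be integrated: the linearisation error is at most a
  constant times the square of \<open>cmod (y - w)\<close>.\<close>

lemma kernel_integral_has_derivative:
  fixes v :: "complex \<Rightarrow> real"
  assumes \<kappa>: "C_k_on 2 UNIV \<kappa>" and v: "integrable \<sigma> v"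
    and R: "{z. v z \<noteq> 0} \<subseteq> cball 0 R" and id: "(\<lambda>z. z) \<in> borel_measurable \<sigma>"
  shows "((\<lambda>w. \<integral>z. v z * \<kappa> (w - z) \<partial>\<sigma>) has_derivative
      (\<lambda>e. \<integral>z. v z * partial e \<kappa> (w - z) \<partial>\<sigma>)) (at w)"
proof -
  have d: "\<kappa> differentiable (at z)" for z
    using \<kappa> by (auto simp: numeral_2_eq_2)
  have "C_k_on 1 UNIV (partial 1 \<kappa>)" "C_k_on 1 UNIV (partial \<i> \<kappa>)"
    using \<kappa> by (auto simp: numeral_2_eq_2)
  then have c: "continuous_on UNIV \<kappa>" "continuous_on UNIV (partial 1 \<kappa>)" "continuous_on UNIV (partial \<i> \<kappa>)"
    using C_k_on_imp_continuous_on \<kappa> by blast+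
  note int = integrable_kernel[OF _ v R id]
  \<comment> \<open>This radius covers \<open>w - z\<close> and \<open>y - z\<close> whenever
    \<open>z\<close> is in the support of \<open>v\<close> and \<open>y\<close> is within 1 of
    \<open>w\<close>.\<close>
  obtain B where B: "B \<ge> 0" "\<And>x y. x \<in> cball 0 (cmod w + 1 + R) \<Longrightarrow> y \<in> cball 0 (cmod w + 1 + R) \<Longrightarrow>
       \<bar>\<kappa> y - \<kappa> x - partial (y - x) \<kappa> x\<bar> \<le> B * cmod (y - x) ^ 2"
    using C_k_on_quadratic_remainder[OF \<kappa>] by metis
  have Ae: "(\<lambda>z. v z * partial e \<kappa> (w - z)) =
     (\<lambda>z. Re e * (v z * partial 1 \<kappa> (w - z)) + Im e * (v z * partial \<i> \<kappa> (w - z)))" for e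
    by (rule ext, subst partial_Re_Im[OF d]) (simp add: algebra_simps)
  have ie: "integrable \<sigma> (\<lambda>z. v z * partial e \<kappa> (w - z))" for e
    unfolding Ae using int[OF c(2)] int[OF c(3)] by (intro Bochner_Integration.integrable_add integrable_mult_right) auto
  have Ie: "(\<integral>z. v z * partial e \<kappa> (w - z) \<partial>\<sigma>) =
     Re e * (\<integral>z. v z * partial 1 \<kappa> (w - z) \<partial>\<sigma>) + Im e * (\<integral>z. v z * partial \<i> \<kappa> (w - z) \<partial>\<sigma>)" for e
    unfolding Ae using int[OF c(2)] int[OF c(3)] by simp
  let ?H = "\<lambda>y. (\<integral>z. \<bar>v z\<bar> \<partial>\<sigma>) * B * cmod (y - w)"
  show ?thesis
  proof (rule has_derivativeI_sandwich[where e = 1 and H = ?H])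
    show "(0::real) < 1" by simp
    show "bounded_linear (\<lambda>e. \<integral>z. v z * partial e \<kappa> (w - z) \<partial>\<sigma>)"
      by (subst Ie)
         (rule bounded_linear_add[OF bounded_linear_compose[OF bounded_linear_mult_left bounded_linear_Re]
            bounded_linear_compose[OF bounded_linear_mult_left bounded_linear_Im]])
    have "(?H \<longlongrightarrow> (\<integral>z. \<bar>v z\<bar> \<partial>\<sigma>) * B * cmod (w - w)) (at w)"
      by (intro tendsto_intros)
    then show "(?H \<longlongrightarrow> 0) (at w)" by simp
    fix y assume y: "y \<noteq> w" "dist y w < 1"
    have "\<bar>(\<integral>z. v z * \<kappa> (y - z) \<partial>\<sigma>) - (\<integral>z. v z * \<kappa> (w - z) \<partial>\<sigma>) - (\<integral>z. v z * partial (y - w) \<kappa> (w - z) \<partial>\<sigma>)\<bar>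
       = \<bar>\<integral>z. v z * (\<kappa> (y - z) - \<kappa> (w - z) - partial (y - w) \<kappa> (w - z)) \<partial>\<sigma>\<bar>"
      using int[OF c(1)] ie by (simp add: right_diff_distrib)
    also have "\<dots> \<le> (\<integral>z. \<bar>v z\<bar> * (B * cmod (y - w) ^ 2) \<partial>\<sigma>)"
    proof (rule integral_abs_bound_integral)
      show "integrable \<sigma> (\<lambda>z. v z * (\<kappa> (y - z) - \<kappa> (w - z) - partial (y - w) \<kappa> (w - z)))"
        using int[OF c(1)] ie by (simp add: right_diff_distrib)
      show "integrable \<sigma> (\<lambda>z. \<bar>v z\<bar> * (B * cmod (y - w) ^ 2))"
        using v by simp
      fix z
      show "\<bar>v z * (\<kappa> (y - z) - \<kappa> (w - z) - partial (y - w) \<kappa> (w - z))\<bar> \<le> \<bar>v z\<bar> * (B * cmod (y - w) ^ 2)"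
      proof (cases "v z = 0")
        case False
        have "cmod y \<le> cmod w + 1"
          using y(2) norm_triangle_sub[of y w] by (simp add: dist_norm)
        then have "y - z \<in> cball 0 (cmod w + 1 + R)" "w - z \<in> cball 0 (cmod w + 1 + R)"
          using R False norm_triangle_ineq4[of w z] norm_triangle_ineq4[of y z] by fastforce+
        from B(2)[OF this(2,1)] show ?thesis
          by (auto simp: abs_mult intro!: mult_left_mono)
      qed simp
    qed
    also have "\<dots> = ?H y * cmod (y - w)"
      by (simp add: power2_eq_square)
    finally have "norm ((\<integral>z. v z * \<kappa> (y - z) \<partial>\<sigma>) - (\<integral>z. v z * \<kappa> (w - z) \<partial>\<sigma>) - (\<integral>z. v z * partial (y - w) \<kappa> (w - z) \<partial>\<sigma>))
       \<le> ?H y * norm (y - w)"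
      by (simp only: real_norm_def)
    moreover have "norm (y - w) > 0"
      using y(1) by simp
    ultimately show "norm ((\<integral>z. v z * \<kappa> (y - z) \<partial>\<sigma>) - (\<integral>z. v z * \<kappa> (w - z) \<partial>\<sigma>) - (\<integral>z. v z * partial (y - w) \<kappa> (w - z) \<partial>\<sigma>))
       / norm (y - w) \<le> ?H y"
      by (simp only: pos_divide_le_eq)
  qed
qed

text \<open>A partial derivative of the integral is an integral of the same shape with the kernel
  \<open>partial e \<kappa>\<close>. Hence \<open>\<kappa>\<close> is generalised in the induction
  and assumed smooth of every order.\<close>

lemma C_k_on_kernel_integral:
  fixes v :: "complex \<Rightarrow> real"
  assumes \<kappa>: "\<And>k. C_k_on k UNIV \<kappa>" and v: "integrable \<sigma> v"
    and R: "{z. v z \<noteq> 0} \<subseteq> cball 0 R" and id: "(\<lambda>z. z) \<in> borel_measurable \<sigma>"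
  shows "C_k_on k UNIV (\<lambda>w. \<integral>z. v z * \<kappa> (w - z) \<partial>\<sigma>)"
  using \<kappa>
proof (induction k arbitrary: \<kappa>)
  case 0
  have "isCont (\<lambda>w. \<integral>z. v z * \<kappa> (w - z) \<partial>\<sigma>) w" for w
    by (rule has_derivative_continuous[OF kernel_integral_has_derivative[OF 0 v R id]])
  then show ?case by (simp add: continuous_at_imp_continuous_on)
next
  case (Suc k)
  note D = kernel_integral_has_derivative[OF Suc.prems v R id]
  have "partial e (\<lambda>w. \<integral>z. v z * \<kappa> (w - z) \<partial>\<sigma>) = (\<lambda>w. \<integral>z. v z * partial e \<kappa> (w - z) \<partial>\<sigma>)" for e
    by (rule ext) (rule partial_eq_derivative[OF D])
  moreover have "C_k_on j UNIV (partial 1 \<kappa>)" "C_k_on j UNIV (partial \<i> \<kappa>)" for j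
    using Suc.prems[of "Suc j"] by auto
  moreover have "(\<lambda>w. \<integral>z. v z * \<kappa> (w - z) \<partial>\<sigma>) differentiable (at w)" for w
    using D unfolding differentiable_def by blast
  ultimately show ?case
    using Suc.IH by simp
qed

lemma laplacian_kernel_integral:
  fixes v :: "complex \<Rightarrow> real"
  assumes \<kappa>: "\<And>k. C_k_on k UNIV \<kappa>" and v: "integrable \<sigma> v"
    and R: "{z. v z \<noteq> 0} \<subseteq> cball 0 R" and id: "(\<lambda>z. z) \<in> borel_measurable \<sigma>"
  shows "laplacian (\<lambda>w. \<integral>z. v z * \<kappa> (w - z) \<partial>\<sigma>) w = (\<integral>z. v z * laplacian \<kappa> (w - z) \<partial>\<sigma>)"
proof -
  have P: "partial e (\<lambda>w. \<integral>z. v z * \<kappa>' (w - z) \<partial>\<sigma>) = (\<lambda>w. \<integral>z. v z * partial e \<kappa>' (w - z) \<partial>\<sigma>)"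
    if "C_k_on 2 UNIV \<kappa>'" for e and \<kappa>'
    by (rule ext) (rule partial_eq_derivative[OF kernel_integral_has_derivative[OF that v R id]])
  have C: "C_k_on k UNIV (partial 1 \<kappa>)" "C_k_on k UNIV (partial \<i> \<kappa>)" for k
    using \<kappa>[of "Suc k"] by auto
  have "C_k_on k UNIV (partial 1 (partial 1 \<kappa>))" "C_k_on k UNIV (partial \<i> (partial \<i> \<kappa>))" for k
    using C[of "Suc k"] by auto
  then have "continuous_on UNIV (partial 1 (partial 1 \<kappa>))" "continuous_on UNIV (partial \<i> (partial \<i> \<kappa>))"
    using C_k_on_imp_continuous_on by blast+
  note i = this[THEN integrable_kernel[OF _ v R id]]
  have "laplacian (\<lambda>w. \<integral>z. v z * \<kappa> (w - z) \<partial>\<sigma>) w =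
     (\<integral>z. v z * partial 1 (partial 1 \<kappa>) (w - z) \<partial>\<sigma>) + (\<integral>z. v z * partial \<i> (partial \<i> \<kappa>) (w - z) \<partial>\<sigma>)"
    by (simp only: laplacian_def P[OF \<kappa>] P[OF C(1)] P[OF C(2)])
  also have "\<dots> = (\<integral>z. v z * laplacian \<kappa> (w - z) \<partial>\<sigma>)"
    using i by (simp add: laplacian_def distrib_left)
  finally show ?thesis .
qed

section \<open>Smooth truncations of the logarithm\<close>

lemma tendsto_poly_exp_at_top: "((\<lambda>t. poly p t * exp (- t)) \<longlongrightarrow> 0) (at_top :: real filter)"
proof -
  have "((\<lambda>t. \<Sum>i\<le>degree p. coeff p i * (t ^ i / exp t)) \<longlongrightarrow> (\<Sum>i\<le>degree p. coeff p i * 0)) at_top"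
    by (intro tendsto_intros tendsto_power_div_exp_0)
  moreover have "(\<lambda>t. \<Sum>i\<le>degree p. coeff p i * (t ^ i / exp t)) = (\<lambda>t. poly p t * exp (- t))"
    by (simp add: poly_altdef sum_divide_distrib exp_minus divide_inverse sum_distrib_right mult.assoc)
  ultimately show ?thesis by simp
qed

text \<open>The family of all \<open>P(1/x) exp(-1/x)\<close> with a polynomial \<open>P\<close> is closed under differentiation,
  which makes its members smooth at 0.\<close>

definition flat_exp :: "real poly \<Rightarrow> real \<Rightarrow> real" where
  "flat_exp p x = (if x > 0 then poly p (1 / x) * exp (- (1 / x)) else 0)"

lemma tendsto_flat_exp_0: "(flat_exp p \<longlongrightarrow> 0) (at 0)"
proof (rule filterlim_split_at)
  show "(flat_exp p \<longlongrightarrow> 0) (at_left 0)"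
    by (rule tendsto_eventually) (auto simp: flat_exp_def eventually_at_filter)
  have "((\<lambda>x. poly p (inverse x) * exp (- inverse x)) \<longlongrightarrow> 0) (at_right 0)"
    by (rule filterlim_compose[OF tendsto_poly_exp_at_top filterlim_inverse_at_top_right])
  moreover have "\<forall>\<^sub>F x in at_right 0. poly p (inverse x) * exp (- inverse x) = flat_exp p x"
    by (auto simp: flat_exp_def eventually_at_filter inverse_eq_divide)
  ultimately show "(flat_exp p \<longlongrightarrow> 0) (at_right 0)"
    by (rule Lim_transform_eventually)
qed

text \<open>With t = 1/x one has dt/dx = -t^2, so P(t) exp(-t) has the derivative t^2 (P(t) - P'(t))
  exp(-t). At 0 the difference quotient is the member of the family with polynomial t P(t), which
  tends to 0.\<close>

lemma DERIV_flat_exp: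
  "(flat_exp p has_real_derivative flat_exp ([:0, 0, 1:] * (p - pderiv p)) x) (at x)"
proof -
  consider "x > 0" | "x < 0" | "x = 0" by linarith
  then show ?thesis
  proof cases
    case 1
    have "((\<lambda>x. poly p (1 / x) * exp (- (1 / x))) has_real_derivative
        flat_exp ([:0, 0, 1:] * (p - pderiv p)) x) (at x)"
      using 1 by (auto intro!: derivative_eq_intros poly_DERIV[THEN DERIV_chain2]
          simp: flat_exp_def field_simps power2_eq_square)
    then show ?thesis
      by (rule has_field_derivative_transform_within_open[of _ _ _ "{0<..}"])
         (use 1 in \<open>auto simp: flat_exp_def\<close>)
  next
    case 2
    have "((\<lambda>_. 0) has_real_derivative 0) (at x)" by simp
    then have "(flat_exp p has_real_derivative 0) (at x)"
      by (rule has_field_derivative_transform_within_open[of _ _ _ "{..<0}"])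
         (use 2 in \<open>auto simp: flat_exp_def\<close>)
    then show ?thesis using 2 by (simp add: flat_exp_def)
  next
    case 3
    have "(flat_exp p h - flat_exp p 0) / h = flat_exp ([:0, 1:] * p) h" for h
      by (auto simp: flat_exp_def field_simps)
    then have "(\<lambda>h. (flat_exp p (0 + h) - flat_exp p 0) / h) \<midarrow>0\<rightarrow> 0"
      using tendsto_flat_exp_0[of "[:0, 1:] * p"] by simp
    then show ?thesis using 3 by (simp add: DERIV_def flat_exp_def)
  qed
qed

lemma C_k_on_flat_exp:
  assumes "open S" "\<And>k. C_k_on k S q"
  shows "C_k_on k S (\<lambda>z. flat_exp p (q z))"
proof (induction k arbitrary: p)
  case 0
  have "continuous_on UNIV (flat_exp p)"
    using DERIV_flat_exp by (intro continuous_at_imp_continuous_on ballI DERIV_isCont)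
  then show ?case
    using assms(2)[of 0] continuous_on_compose2[of UNIV "flat_exp p" S q] by simp
next
  case (Suc k)
  show ?case
    by (rule C_k_on_chain_Suc[where q = q and G = "flat_exp p"
        and g = "flat_exp ([:0, 0, 1:] * (p - pderiv p))"])
       (rule assms DERIV_flat_exp Suc.IH)+
qed

section \<open>The radial profile of the smooth logarithm\<close>

lemma continuous_imp_antiderivative:
  assumes "\<And>x. isCont (f :: real \<Rightarrow> real) x"
  obtains F where "\<And>x. (F has_real_derivative f x) (at x)"
  using einterval_antiderivative[of "-\<infinity>" \<infinity> f] assms
  by (auto simp: has_real_derivative_iff_has_vector_derivative)

lemma DERIV_0_const_on:
  assumes "convex S" "x \<in> S" "y \<in> S" "\<And>s. s \<in> S \<Longrightarrow> (f has_real_derivative 0) (at s)"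
  shows "f x = (f y :: real)"
proof -
  have "\<exists>c. \<forall>s\<in>S. f s = c"
    using has_field_derivative_zero_constant[OF assms(1), of f] assms(4)
      has_field_derivative_at_within by blast
  then show ?thesis using assms(2,3) by auto
qed

text \<open>The square, unlike the modulus, is smooth at \<open>w\<close>; the scaling makes the
  disc of radius \<delta> > 0 the set of values below 1.\<close>

definition sq_dist :: "complex \<Rightarrow> real \<Rightarrow> complex \<Rightarrow> real" where
  "sq_dist w \<delta> z = (cmod (z - w))\<^sup>2 / \<delta>\<^sup>2"

lemma sq_dist_inner: "sq_dist w \<delta> z = 1 / \<delta>\<^sup>2 * (((z - w) \<bullet> 1) * ((z - w) \<bullet> 1) + ((z - w) \<bullet> \<i>) * ((z - w) \<bullet> \<i>))"
  unfolding sq_dist_def cmod_power2 by (simp add: power2_eq_square inner_complex_def)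

lemma C_k_on_sq_dist: "C_k_on k UNIV (sq_dist w \<delta>)"
  unfolding sq_dist_inner[abs_def]
  by (intro C_k_on_cmult C_k_on_add C_k_on_mult C_k_on_inner open_UNIV)

lemma sq_dist_has_derivative:
  "(sq_dist w \<delta> has_derivative (\<lambda>v. 2 / \<delta>\<^sup>2 * ((z - w) \<bullet> v))) (at z)"
proof -
  have *: "sq_dist w \<delta> = (\<lambda>z. 1 / \<delta>\<^sup>2 * ((z - w) \<bullet> (z - w)))"
    by (rule ext) (simp add: sq_dist_def power2_norm_eq_inner)
  show ?thesis
    unfolding * by (rule derivative_eq_intros refl)+ (auto simp: inner_commute algebra_simps diff_divide_distrib)
qed

text \<open>\<open>G (\<bar>z\<bar>\<^sup>2)\<close> is a smooth radial modification of \<open>log \<bar>z\<bar>\<close> inside the unit disc, with Laplacian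
  \<open>2 b (\<bar>z\<bar>\<^sup>2)\<close>.\<close>

locale log_profile =
  fixes G g g' b :: "real \<Rightarrow> real"
  assumes DERIV_G: "(G has_real_derivative g s) (at s)"
    and DERIV_g: "(g has_real_derivative g' s) (at s)"
    and radial_laplacian: "s * g' s + g s = b s / 2"
    and b_nonneg: "b s \<ge> 0"
    and b_pos: "1/4 < s \<Longrightarrow> s < 1 \<Longrightarrow> b s > 0"
    and b_support: "b s \<noteq> 0 \<Longrightarrow> 1/4 < s \<and> s < 1"
    and b_measurable: "b \<in> borel_measurable borel"
    and b_integral: "(\<integral>\<^sup>+s. ennreal (b s) \<partial>lborel) = 1"
    and G_eq_ln: "s \<ge> 1 \<Longrightarrow> G s = ln s / 2"
    and G_antimono: "0 < s \<Longrightarrow> s \<le> t \<Longrightarrow> G t - ln t / 2 \<le> G s - ln s / 2"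
    and C_k_on_G: "\<delta> > 0 \<Longrightarrow> C_k_on k UNIV (\<lambda>z. G (sq_dist w \<delta> z))"

text \<open>With s = |z|^2, log |z| is ln s / 2, with derivative 1 / (2 s). Multiplying this
  derivative by a smooth step \<open>\<theta>\<close> from 0 to 1 removes the singularity at 0 and
  keeps the logarithm for s \<ge> 1. As s g = \<open>\<theta>\<close> / 2, the expression s g' + g =
  (s g)' is half of \<open>\<theta>\<close>', so \<open>b\<close> is the derivative of the step:
  nonnegative because \<open>\<theta>\<close> increases, of integral 1 because it climbs from 0 to
  1. The step happens between 1/4 and 1, that is, for 1/2 < |z| < 1.\<close>

lemma log_profile_exists: "\<exists>G g g' b. log_profile G g g' b"
proof -
  define \<beta> where "\<beta> s = flat_exp 1 (s - 1/4) * flat_exp 1 (1 - s)" for s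
  have cont: "isCont \<beta> s" for s
    unfolding \<beta>_def
    by (intro continuous_intros isCont_o2[where g = "flat_exp 1", OF _ DERIV_isCont[OF DERIV_flat_exp]])
  have \<beta>_nonneg: "\<beta> s \<ge> 0" for s
    by (simp add: \<beta>_def flat_exp_def)
  have \<beta>_pos: "\<beta> s > 0" if "1/4 < s" "s < 1" for s
    using that by (simp add: \<beta>_def flat_exp_def)
  have \<beta>_0: "\<beta> s = 0" if "s \<le> 1/4 \<or> 1 \<le> s" for s
    using that by (auto simp: \<beta>_def flat_exp_def)
  obtain B where B: "\<And>s. (B has_real_derivative \<beta> s) (at s)"
    using continuous_imp_antiderivative[OF cont] by blast
  have B_left: "B s = B 0" if "s \<le> 1/4" for s
    by (rule DERIV_0_const_on[of "{..1/4}"]) (use that B \<beta>_0 in \<open>auto, metis\<close>)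
  have B_right: "B s = B 1" if "s \<ge> 1" for s
    by (rule DERIV_0_const_on[of "{1..}"]) (use that B \<beta>_0 in \<open>auto, metis\<close>)
  have B_mono: "B s \<le> B t" if "s \<le> t" for s t
    by (rule DERIV_nonneg_imp_nondecreasing[OF that]) (use B \<beta>_nonneg in blast)
  have "B (1/4) < B 1"
    by (rule DERIV_pos_imp_increasing_open)
       (use B \<beta>_pos in \<open>auto intro!: continuous_at_imp_continuous_on DERIV_isCont\<close>)
  then have B01: "B 0 < B 1" using B_left[of "1/4"] by simp
  define c where "c = B 1 - B 0"
  have c: "c > 0" using B01 by (simp add: c_def)
  define \<theta> where "\<theta> s = (B s - B 0) / c" for s
  define b where "b s = \<beta> s / c" for s
  have \<theta>': "(\<theta> has_real_derivative b s) (at s)" for s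
    unfolding \<theta>_def b_def using c by (auto intro!: derivative_eq_intros B)
  have \<theta>_left: "\<theta> s = 0" if "s \<le> 1/4" for s using B_left[OF that] by (simp add: \<theta>_def)
  have \<theta>_right: "\<theta> s = 1" if "s \<ge> 1" for s using B_right[OF that] B01 by (simp add: \<theta>_def c_def)
  have \<theta>_le_1: "\<theta> s \<le> 1" for s
    using B_mono[of s 1] \<theta>_right[of s] c by (cases "s \<le> 1") (auto simp: \<theta>_def c_def)
  have b_nonneg: "b s \<ge> 0" for s using \<beta>_nonneg[of s] c by (simp add: b_def)
  define g where "g s = \<theta> s / (2 * s)" for s
  \<comment> \<open>Any threshold strictly between 0 and 1/4 serves: to its right the quotient rule
    applies, and below 1/4 the step, hence \<open>g\<close>, is 0.\<close>
  define g' where "g' s = (if s > 1/8 then (b s * s - \<theta> s) / (2 * s\<^sup>2) else 0)" for s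
  have g': "(g has_real_derivative g' s) (at s)" for s
  proof (cases "s > 1/8")
    case True
    then show ?thesis
      unfolding g_def g'_def by (auto intro!: derivative_eq_intros \<theta>' simp: field_simps power2_eq_square)
  next
    case False
    have "((\<lambda>_. 0) has_real_derivative 0) (at s)" by simp
    then have "(g has_real_derivative 0) (at s)"
      by (rule has_field_derivative_transform_within_open[of _ _ _ "{..<1/4}"])
         (use False \<theta>_left in \<open>auto simp: g_def\<close>)
    then show ?thesis using False by (simp add: g'_def)
  qed
  obtain G0 where G0: "\<And>s. (G0 has_real_derivative g s) (at s)"
    using continuous_imp_antiderivative[of g] g' DERIV_isCont by blast
  \<comment> \<open>The constant is fixed by \<open>G 1 = 0 = ln 1 / 2\<close>.\<close>
  define G where "G s = G0 s - G0 1" for s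
  have G: "(G has_real_derivative g s) (at s)" for s
    unfolding G_def by (auto intro!: derivative_eq_intros G0)
  \<comment> \<open>Both comparisons with the logarithm come from this derivative: it is never
    positive, since \<open>\<theta>\<close> is at most 1, and it vanishes for
    \<open>s \<ge> 1\<close>.\<close>
  have H: "((\<lambda>s. G s - ln s / 2) has_real_derivative (\<theta> s - 1) / (2 * s)) (at s)" if "s > 0" for s
    using that by (auto intro!: derivative_eq_intros G simp: g_def field_simps)
  have "C_k_on k UNIV (\<lambda>z. G (sq_dist w \<delta> z))" if "\<delta> > 0" for k w \<delta>
  proof -
    let ?q = "sq_dist w \<delta>"
    note q = C_k_on_sq_dist[of _ w \<delta>]
    have "C_k_on k UNIV (\<lambda>z. 1 / c * (flat_exp 1 (?q z - 1/4) * flat_exp 1 (1 - ?q z)))" for k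
      by (intro C_k_on_cmult C_k_on_mult C_k_on_flat_exp C_k_on_diff q C_k_on_const open_UNIV)
    then have 1: "C_k_on k UNIV (\<lambda>z. b (?q z))" for k
      by (simp add: b_def \<beta>_def)
    have 2: "C_k_on k UNIV (\<lambda>z. \<theta> (?q z))" for k
      using C_k_on_chain_Suc[where G = \<theta> and g = b and q = ?q, OF open_UNIV \<theta>' 1 q] by (rule C_k_on_SucD)
    have qc: "continuous_on UNIV ?q" using q C_k_on_imp_continuous_on by blast
    have 3: "C_k_on k UNIV (\<lambda>z. g (?q z))" for k
    proof (rule C_k_on_locally)
      fix z
      \<comment> \<open>The open sets where \<open>?q\<close> exceeds 1/8 and where it is below 1/4
        cover the plane; on the first the division by \<open>?q\<close> is smooth, on the second the
        function is 0.\<close>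
      show "\<exists>U. open U \<and> z \<in> U \<and> C_k_on k U (\<lambda>z. g (?q z))"
      proof (cases "?q z > 1/8")
        case True
        let ?U = "{z. 1/8 < ?q z}"
        have U: "open ?U" using qc by (intro open_Collect_less continuous_on_const)
        have "C_k_on k ?U (\<lambda>z. \<theta> (?q z))" "C_k_on k ?U ?q"
          using C_k_on_subset[OF 2] C_k_on_subset[OF q] by blast+
        then have "C_k_on k ?U (\<lambda>z. \<theta> (?q z) * inverse (2 * ?q z))"
          by (rule C_k_on_mult[OF U _ C_k_on_inverse[OF U C_k_on_cmult[OF U]]]) auto
        then have "C_k_on k ?U (\<lambda>z. g (?q z))"
          by (simp only: g_def divide_inverse)
        then show ?thesis using U True by blast
      next
        case False
        let ?U = "{z. ?q z < 1/4}"
        have U: "open ?U" using qc by (intro open_Collect_less continuous_on_const)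
        have "C_k_on k ?U (\<lambda>z. g (?q z)) \<longleftrightarrow> C_k_on k ?U (\<lambda>z. 0)"
          by (rule C_k_on_cong[OF U]) (simp add: g_def \<theta>_left)
        then show ?thesis using U False C_k_on_const by fastforce
      qed
    qed
    show ?thesis
      using C_k_on_chain_Suc[where G = G and g = g and q = ?q, OF open_UNIV G 3 q] by (rule C_k_on_SucD)
  qed
  moreover have b_meas: "b \<in> borel_measurable borel"
  proof -
    have "isCont b s" for s unfolding b_def using c by (intro continuous_intros cont) simp
    then show ?thesis
      by (intro borel_measurable_continuous_onI continuous_at_imp_continuous_on) simp
  qed
  moreover have "(\<integral>\<^sup>+s. ennreal (b s) \<partial>lborel) = 1"
  proof -
    have "(\<integral>\<^sup>+s. ennreal (b s) * indicator {0..1} s \<partial>lborel) = ennreal (\<theta> 1 - \<theta> 0)"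
      by (intro nn_integral_FTC_Icc) (use b_nonneg \<theta>' b_meas in auto)
    moreover have "(\<lambda>s. ennreal (b s) * indicator {0..1} s) = (\<lambda>s. ennreal (b s))"
    proof
      fix s
      show "ennreal (b s) * indicator {0..1} s = ennreal (b s)"
        using \<beta>_0[of s] by (cases "s \<in> {0..1}") (auto simp: b_def)
    qed
    ultimately show ?thesis using \<theta>_left[of 0] \<theta>_right[of 1] by simp
  qed
  moreover have "s * g' s + g s = b s / 2" for s
    using \<theta>_left[of s] \<beta>_0[of s] by (auto simp: g'_def g_def b_def field_simps power2_eq_square)
  moreover have "G s = ln s / 2" if "s \<ge> 1" for s
  proof -
    have "G s - ln s / 2 = G 1 - ln 1 / 2"
    proof (rule DERIV_0_const_on[where f = "\<lambda>s. G s - ln s / 2" and S = "{1..}"])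
      show "((\<lambda>s. G s - ln s / 2) has_real_derivative 0) (at s)" if "s \<in> {1..}" for s
        using H[of s] \<theta>_right[of s] that by simp
    qed (use that in auto)
    then show ?thesis by (simp add: G_def)
  qed
  moreover have "G t - ln t / 2 \<le> G s - ln s / 2" if "0 < s" "s \<le> t" for s t
  proof (rule DERIV_nonpos_imp_nonincreasing[OF that(2)])
    fix x assume "s \<le> x"
    then have x: "x > 0" using that by simp
    then have "(\<theta> x - 1) / (2 * x) \<le> 0"
      using \<theta>_le_1[of x] by (intro divide_nonpos_pos) auto
    with H[OF x] show "\<exists>y. ((\<lambda>s. G s - ln s / 2) has_real_derivative y) (at x) \<and> y \<le> 0"
      by blast
  qed
  moreover have "b s > 0" if "1/4 < s" "s < 1" for s
    using \<beta>_pos[OF that] c by (simp add: b_def)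
  moreover have "1/4 < s \<and> s < 1" if "b s \<noteq> 0" for s
    using \<beta>_0[of s] that by (auto simp: b_def) (metis linorder_not_less)+
  ultimately have "log_profile G g g' b"
    by (intro log_profile.intro G g' b_nonneg) auto
  then show ?thesis by blast
qed

section \<open>The rescaled smooth logarithms and their Laplacians\<close>

context log_profile
begin

text \<open>The function \<open>L_\<delta>(z - w)\<close> of the overview. The summand
  \<open>ln \<delta>\<close> undoes the rescaling: outside the disc the first summand is ln (|z - w|
  / \<delta>).\<close>

definition smooth_log :: "complex \<Rightarrow> real \<Rightarrow> complex \<Rightarrow> real" where
  "smooth_log w \<delta> z = G (sq_dist w \<delta> z) + ln \<delta>"

text \<open>The function \<open>\<chi>_\<delta>(z - w)\<close> of the overview. The set where
  \<open>sq_dist\<close> is at most a \<ge> 0 has area pi \<delta>^2 a, and division by pi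
  \<delta>^2 gives the bump the mass of \<open>b\<close>, which is 1.\<close>

definition bump :: "complex \<Rightarrow> real \<Rightarrow> complex \<Rightarrow> real" where
  "bump w \<delta> z = b (sq_dist w \<delta> z) / (pi * \<delta>\<^sup>2)"

lemma C_k_on_smooth_log: "\<delta> > 0 \<Longrightarrow> C_k_on k UNIV (smooth_log w \<delta>)"
  unfolding smooth_log_def[abs_def] by (intro C_k_on_add C_k_on_G C_k_on_const open_UNIV)

text \<open>For a function G(s) of s = |z - w|^2 / \<delta>^2 the Laplacian is 4 / \<delta>^2 times
  s G'' + G', and \<open>radial_laplacian\<close> turns this into 2 b(s) / \<delta>^2.\<close>

lemma laplacian_smooth_log:
  assumes "\<delta> > 0"
  shows "laplacian (smooth_log w \<delta>) = (\<lambda>z. 2 * pi * bump w \<delta> z)"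
proof
  fix z
  have 1: "partial v (smooth_log w \<delta>) = (\<lambda>z. g (sq_dist w \<delta> z) * (2 / \<delta>\<^sup>2 * ((z - w) \<bullet> v)))" for v
  proof
    fix z
    have "((\<lambda>z. G (sq_dist w \<delta> z)) has_derivative (\<lambda>v. g (sq_dist w \<delta> z) * (2 / \<delta>\<^sup>2 * ((z - w) \<bullet> v)))) (at z)"
      using has_derivative_compose[OF sq_dist_has_derivative DERIV_G[unfolded has_field_derivative_def]] .
    then have "(smooth_log w \<delta> has_derivative (\<lambda>v. g (sq_dist w \<delta> z) * (2 / \<delta>\<^sup>2 * ((z - w) \<bullet> v)))) (at z)"
      unfolding smooth_log_def[abs_def] by (rule has_derivative_add_const)
    then show "partial v (smooth_log w \<delta>) z = g (sq_dist w \<delta> z) * (2 / \<delta>\<^sup>2 * ((z - w) \<bullet> v))"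
      by (rule partial_eq_derivative)
  qed
  have 2: "partial v (partial v (smooth_log w \<delta>)) z =
      g' (sq_dist w \<delta> z) * (2 / \<delta>\<^sup>2 * ((z - w) \<bullet> v)) * (2 / \<delta>\<^sup>2 * ((z - w) \<bullet> v))
      + g (sq_dist w \<delta> z) * (2 / \<delta>\<^sup>2 * (v \<bullet> v))" for v
  proof -
    have a: "((\<lambda>z. g (sq_dist w \<delta> z)) has_derivative (\<lambda>v. g' (sq_dist w \<delta> z) * (2 / \<delta>\<^sup>2 * ((z - w) \<bullet> v)))) (at z)"
      using has_derivative_compose[OF sq_dist_has_derivative DERIV_g[unfolded has_field_derivative_def]] .
    have b: "((\<lambda>z. 2 / \<delta>\<^sup>2 * ((z - w) \<bullet> v)) has_derivative (\<lambda>e. 2 / \<delta>\<^sup>2 * (e \<bullet> v))) (at z)"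
      by (rule has_derivative_mult_right) (auto intro!: derivative_eq_intros)
    show ?thesis
      unfolding 1 using partial_eq_derivative[OF has_derivative_mult[OF a b], of v] by (simp only: ac_simps)
  qed
  let ?s = "sq_dist w \<delta> z"
  have s: "((z - w) \<bullet> 1)\<^sup>2 + ((z - w) \<bullet> \<i>)\<^sup>2 = \<delta>\<^sup>2 * ?s"
    using assms by (simp add: sq_dist_inner power2_eq_square)
  have "laplacian (smooth_log w \<delta>) z = 4 / \<delta>^4 * g' ?s * (((z - w) \<bullet> 1)\<^sup>2 + ((z - w) \<bullet> \<i>)\<^sup>2) + 4 / \<delta>\<^sup>2 * g ?s"
  proof -
    have alg: "(a * (2 / \<delta>\<^sup>2 * X) * (2 / \<delta>\<^sup>2 * X) + c * (2 / \<delta>\<^sup>2 * 1)) + (a * (2 / \<delta>\<^sup>2 * Y) * (2 / \<delta>\<^sup>2 * Y) + c * (2 / \<delta>\<^sup>2 * 1))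
        = 4 / \<delta>^4 * a * (X\<^sup>2 + Y\<^sup>2) + 4 / \<delta>\<^sup>2 * c" for a c X Y
      using assms by (simp add: field_simps power2_eq_square power4_eq_xxxx)
    have "(1::complex) \<bullet> 1 = 1" "\<i> \<bullet> \<i> = 1" by (simp_all add: inner_complex_def)
    then show ?thesis
      unfolding laplacian_def 2 by (simp only: alg)
  qed
  also have "\<dots> = 4 / \<delta>\<^sup>2 * (?s * g' ?s + g ?s)"
    unfolding s using assms by (simp add: field_simps power2_eq_square power4_eq_xxxx)
  also have "\<dots> = 2 * pi * bump w \<delta> z"
    by (simp add: radial_laplacian bump_def)
  finally show "laplacian (smooth_log w \<delta>) z = 2 * pi * bump w \<delta> z" .
qed

text \<open>Smoothness is inherited from \<open>smooth_log\<close>, of which the bump is the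
  Laplacian up to the factor 2 pi; the two orders lost are available because
  \<open>smooth_log\<close> is smooth of every order.\<close>

lemma C_k_on_bump:
  assumes "\<delta> > 0"
  shows "C_k_on k UNIV (bump w \<delta>)"
proof -
  have "C_k_on (Suc (Suc k)) UNIV (smooth_log w \<delta>)"
    by (rule C_k_on_smooth_log[OF assms])
  then have "C_k_on k UNIV (partial 1 (partial 1 (smooth_log w \<delta>)))"
    "C_k_on k UNIV (partial \<i> (partial \<i> (smooth_log w \<delta>)))" by auto
  then have "C_k_on k UNIV (\<lambda>z. 1 / (2 * pi) * laplacian (smooth_log w \<delta>) z)"
    unfolding laplacian_def[abs_def] by (intro C_k_on_cmult C_k_on_add open_UNIV)
  then show ?thesis
    by (simp add: laplacian_smooth_log[OF assms])
qed

lemma continuous_on_bump: "\<delta> > 0 \<Longrightarrow> continuous_on S (bump w \<delta>)"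
  using C_k_on_imp_continuous_on[OF C_k_on_bump] continuous_on_subset by blast

lemma continuous_on_smooth_log: "\<delta> > 0 \<Longrightarrow> continuous_on S (smooth_log w \<delta>)"
  using C_k_on_imp_continuous_on[OF C_k_on_smooth_log] continuous_on_subset by blast

lemma borel_measurable_bump: "\<delta> > 0 \<Longrightarrow> bump w \<delta> \<in> borel_measurable borel"
  by (rule borel_measurable_continuous_onI[OF continuous_on_bump])

lemma borel_measurable_smooth_log: "\<delta> > 0 \<Longrightarrow> smooth_log w \<delta> \<in> borel_measurable borel"
  by (rule borel_measurable_continuous_onI[OF continuous_on_smooth_log])

lemma bump_nonneg: "bump w \<delta> z \<ge> 0"
  by (simp add: bump_def b_nonneg)

lemma bump_support:
  assumes "\<delta> > 0" "bump w \<delta> z \<noteq> 0"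
  shows "\<delta> / 2 < cmod (z - w)" "cmod (z - w) < \<delta>"
proof -
  have "1/4 < sq_dist w \<delta> z" "sq_dist w \<delta> z < 1"
    using assms b_support by (auto simp: bump_def)
  then have "(\<delta> / 2)\<^sup>2 < (cmod (z - w))\<^sup>2" "(cmod (z - w))\<^sup>2 < \<delta>\<^sup>2"
    using assms by (auto simp: sq_dist_def field_simps)
  then show "\<delta> / 2 < cmod (z - w)" "cmod (z - w) < \<delta>"
    using assms by (auto dest: power2_less_imp_less)
qed

lemma bump_pos:
  assumes "\<delta> > 0" "\<delta> / 2 < cmod (z - w)" "cmod (z - w) < \<delta>"
  shows "bump w \<delta> z > 0"
proof -
  have "(\<delta> / 2)\<^sup>2 < (cmod (z - w))\<^sup>2" "(cmod (z - w))\<^sup>2 < \<delta>\<^sup>2"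
    using assms by (auto intro!: power_strict_mono)
  then have "1/4 < sq_dist w \<delta> z" "sq_dist w \<delta> z < 1"
    using assms by (auto simp: sq_dist_def field_simps)
  then show ?thesis
    using assms b_pos by (simp add: bump_def)
qed

lemma smooth_log_eq_ln:
  assumes "\<delta> > 0" "\<delta> \<le> cmod (z - w)"
  shows "smooth_log w \<delta> z = ln (cmod (z - w))"
proof -
  have "\<delta>\<^sup>2 \<le> (cmod (z - w))\<^sup>2" using assms by (intro power_mono) auto
  then have "sq_dist w \<delta> z \<ge> 1" using assms by (simp add: sq_dist_def)
  have "z \<noteq> w" using assms by auto
  with G_eq_ln[OF \<open>sq_dist w \<delta> z \<ge> 1\<close>] show ?thesis
    using assms by (simp add: smooth_log_def sq_dist_def ln_div ln_realpow field_simps)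
qed

lemma smooth_log_decomp:
  assumes "\<delta> > 0" "z \<noteq> w"
  shows "smooth_log w \<delta> z = ln (cmod (z - w)) + (G (sq_dist w \<delta> z) - ln (sq_dist w \<delta> z) / 2)"
  using assms by (simp add: smooth_log_def sq_dist_def ln_div ln_realpow field_simps)

text \<open>A smaller radius makes \<open>sq_dist\<close> larger, and \<open>G s - ln s / 2\<close>,
  the excess over the logarithm, decreases in \<open>s\<close>. The centre is treated apart because
  the logarithm is singular there.\<close>

lemma smooth_log_mono:
  assumes "0 < \<epsilon>" "\<epsilon> \<le> \<delta>"
  shows "smooth_log w \<epsilon> z \<le> smooth_log w \<delta> z"
proof (cases "z = w")
  case True
  then show ?thesis using assms by (simp add: smooth_log_def sq_dist_def)
next
  case False
  have "sq_dist w \<delta> z \<le> sq_dist w \<epsilon> z"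
    using assms by (auto simp: sq_dist_def intro!: divide_left_mono power_mono mult_pos_pos)
  moreover have "sq_dist w \<delta> z > 0" using False assms by (simp add: sq_dist_def)
  ultimately show ?thesis
    using False assms by (simp add: smooth_log_decomp G_antimono)
qed

text \<open>Inside the disc, the smooth logarithm of radius \<open>cmod (z - w)\<close> has exactly
  the value \<open>ln (cmod (z - w))\<close> at \<open>z\<close>, and enlarging the radius only
  increases it.\<close>

lemma ln_le_smooth_log:
  assumes "\<delta> > 0" "z \<noteq> w"
  shows "ln (cmod (z - w)) \<le> smooth_log w \<delta> z"
proof (cases "\<delta> \<le> cmod (z - w)")
  case False
  then show ?thesis
    using smooth_log_mono[of "cmod (z - w)" \<delta> w z] smooth_log_eq_ln[of "cmod (z - w)" z w] assms by simp
qed (simp add: smooth_log_eq_ln assms)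

text \<open>Radial symmetry moves the centre into the argument \<open>w - z\<close>, the convolution
  form in which the kernel integrals are stated.\<close>

lemma smooth_log_0: "smooth_log 0 \<delta> (w - z) = smooth_log w \<delta> z"
  and bump_0: "bump 0 \<delta> (w - z) = bump w \<delta> z"
  by (simp_all add: smooth_log_def bump_def sq_dist_def norm_minus_commute)

end

section \<open>Radial averages and extended-real integrals\<close>

lemma borel_measurable_Complex [measurable (raw)]:
  assumes "f \<in> borel_measurable M" "g \<in> borel_measurable M"
  shows "(\<lambda>x. Complex (f x) (g x)) \<in> borel_measurable M"
  using assms by (simp add: borel_measurable_complex_iff)

lemma distr_Complex_lborel:
  "distr (lborel \<Otimes>\<^sub>M lborel) borel (\<lambda>p. Complex (fst p) (snd p)) = lborel"
proof (rule sym, rule lborel_eqI)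
  fix l u :: complex
  assume le: "\<And>b. b \<in> Basis \<Longrightarrow> l \<bullet> b \<le> u \<bullet> b"
  have "Re l \<le> Re u" "Im l \<le> Im u"
    using le[of 1] le[of \<i>] by (auto simp: Basis_complex_def)
  moreover have "(\<lambda>p. Complex (fst p) (snd p)) -` box l u = {Re l<..<Re u} \<times> {Im l<..<Im u}"
    by (auto simp: box_def Basis_complex_def)
  ultimately have "emeasure (distr (lborel \<Otimes>\<^sub>M lborel) borel (\<lambda>p. Complex (fst p) (snd p))) (box l u)
      = ennreal (Re u - Re l) * ennreal (Im u - Im l)"
    by (subst emeasure_distr) (auto simp: space_pair_measure lborel.emeasure_pair_measure_Times)
  also have "\<dots> = ennreal (\<Prod>b\<in>Basis. (u - l) \<bullet> b)"
    using \<open>Re l \<le> Re u\<close> by (simp add: Basis_complex_def ennreal_mult')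
  finally show "emeasure (distr (lborel \<Otimes>\<^sub>M lborel) borel (\<lambda>p. Complex (fst p) (snd p))) (box l u)
      = ennreal (\<Prod>b\<in>Basis. (u - l) \<bullet> b)" .
qed simp

lemma nn_integral_lborel_Complex:
  assumes [measurable]: "f \<in> borel_measurable borel"
  shows "(\<integral>\<^sup>+z. f z \<partial>lborel) = (\<integral>\<^sup>+x. \<integral>\<^sup>+y. f (Complex x y) \<partial>lborel \<partial>lborel)"
proof -
  have "(\<integral>\<^sup>+z. f z \<partial>lborel) = (\<integral>\<^sup>+p. f (Complex (fst p) (snd p)) \<partial>(lborel \<Otimes>\<^sub>M lborel))"
    by (subst distr_Complex_lborel[symmetric], subst nn_integral_distr) auto
  also have "\<dots> = (\<integral>\<^sup>+x. \<integral>\<^sup>+y. f (Complex x y) \<partial>lborel \<partial>lborel)"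
    by (subst lborel.nn_integral_fst[symmetric]) auto
  finally show ?thesis .
qed

text \<open>The rotation is factored into two substitutions in one real variable each; this needs
  \<open>cos t \<noteq> 0\<close>.\<close>

lemma nn_integral_rotate_aux:
  fixes f :: "complex \<Rightarrow> ennreal"
  assumes [measurable]: "f \<in> borel_measurable borel" and C: "cos t \<noteq> 0"
  shows "(\<integral>\<^sup>+z. f (cis t * z) \<partial>lborel) = (\<integral>\<^sup>+z. f z \<partial>lborel)"
proof -
  let ?C = "cos t" and ?S = "sin t"
  have cs: "?C * ?C + ?S * ?S = 1"
    using sin_cos_squared_add[of t] by (simp add: power2_eq_square add.commute)
  have rot: "cis t * Complex x y = Complex (?C * x - ?S * y) (?S * x + ?C * y)" for x y
    by (simp add: complex_eq_iff)
  \<comment> \<open>For fixed \<open>y\<close> the new variable x' = cos t * x - sin t * y replaces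
    the first coordinate; since cos^2 + sin^2 = 1, the second becomes (sin t * x' + y) / cos
    t.\<close>
  have 1: "ennreal \<bar>?C\<bar> * (\<integral>\<^sup>+x. f (cis t * Complex x y) \<partial>lborel)
      = (\<integral>\<^sup>+x. f (Complex x ((?S * x + y) / ?C)) \<partial>lborel)" for y
  proof -
    have "(?S * (- (?S * y) + ?C * x) + y) / ?C = ?S * x + ?C * y" for x
    proof -
      have "?S * (- (?S * y) + ?C * x) + y = ?C * (?S * x) + (1 - ?S * ?S) * y"
        by (simp add: algebra_simps)
      also have "1 - ?S * ?S = ?C * ?C" using cs by linarith
      finally show ?thesis using C by (simp add: field_simps)
    qed
    then show ?thesis
      by (subst nn_integral_real_affine[of "\<lambda>x. f (Complex x ((?S * x + y) / ?C))" ?C "- (?S * y)"])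
         (use C in \<open>auto simp: rot algebra_simps\<close>)
  qed
  have 2: "(\<integral>\<^sup>+y. f (Complex x ((?S * x + y) / ?C)) \<partial>lborel)
      = ennreal \<bar>?C\<bar> * (\<integral>\<^sup>+y. f (Complex x y) \<partial>lborel)" for x
    by (subst nn_integral_real_affine[of "\<lambda>y. f (Complex x y)" "1 / ?C" "?S * x / ?C"])
       (use C in \<open>auto simp: mult.assoc[symmetric] ennreal_mult[symmetric] add_divide_distrib\<close>)
  have "ennreal \<bar>?C\<bar> * (\<integral>\<^sup>+z. f (cis t * z) \<partial>lborel)
      = ennreal \<bar>?C\<bar> * (\<integral>\<^sup>+x. \<integral>\<^sup>+y. f (cis t * Complex x y) \<partial>lborel \<partial>lborel)"
    by (subst nn_integral_lborel_Complex) auto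
  also have "\<dots> = ennreal \<bar>?C\<bar> * (\<integral>\<^sup>+y. \<integral>\<^sup>+x. f (cis t * Complex x y) \<partial>lborel \<partial>lborel)"
    by (subst lborel_pair.Fubini') auto
  also have "\<dots> = (\<integral>\<^sup>+y. ennreal \<bar>?C\<bar> * (\<integral>\<^sup>+x. f (cis t * Complex x y) \<partial>lborel) \<partial>lborel)"
    by (subst nn_integral_cmult) auto
  also have "\<dots> = (\<integral>\<^sup>+y. \<integral>\<^sup>+x. f (Complex x ((?S * x + y) / ?C)) \<partial>lborel \<partial>lborel)"
    by (simp only: 1)
  also have "\<dots> = (\<integral>\<^sup>+x. \<integral>\<^sup>+y. f (Complex x ((?S * x + y) / ?C)) \<partial>lborel \<partial>lborel)"
    by (subst lborel_pair.Fubini') auto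
  also have "\<dots> = (\<integral>\<^sup>+x. ennreal \<bar>?C\<bar> * (\<integral>\<^sup>+y. f (Complex x y) \<partial>lborel) \<partial>lborel)"
    by (simp only: 2)
  also have "\<dots> = ennreal \<bar>?C\<bar> * (\<integral>\<^sup>+z. f z \<partial>lborel)"
    by (subst nn_integral_cmult, simp_all add: nn_integral_lborel_Complex)
  finally show ?thesis
    using C by (simp add: ennreal_mult_cancel_left)
qed

text \<open>From cos t = 2 cos^2 (t / 2) - 1, the cosine of t / 2 is nonzero when that of t is 0;
  the rotation is then carried out as two rotations by the half angle.\<close>

lemma nn_integral_rotate:
  fixes f :: "complex \<Rightarrow> ennreal"
  assumes f [measurable]: "f \<in> borel_measurable borel"
  shows "(\<integral>\<^sup>+z. f (cis t * z) \<partial>lborel) = (\<integral>\<^sup>+z. f z \<partial>lborel)"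
proof (cases "cos t = 0")
  case True
  then have "cos (t / 2) \<noteq> 0"
    using cos_double[of "t / 2"] sin_cos_squared_add[of "t / 2"] by auto
  note half = nn_integral_rotate_aux[OF _ this]
  have "(\<integral>\<^sup>+z. f (cis t * z) \<partial>lborel) = (\<integral>\<^sup>+z. f (cis (t / 2) * (cis (t / 2) * z)) \<partial>lborel)"
    by (simp add: mult.assoc[symmetric] cis_mult)
  also have "\<dots> = (\<integral>\<^sup>+z. f (cis (t / 2) * z) \<partial>lborel)"
    by (rule half[of "\<lambda>z. f (cis (t / 2) * z)"]) measurable
  also have "\<dots> = (\<integral>\<^sup>+z. f z \<partial>lborel)"
    by (rule half) measurable
  finally show ?thesis .
qed (rule nn_integral_rotate_aux[OF f])

text \<open>The shifted interval is cut at \<open>p\<close> and its tail moved back by one period.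
  Half-open intervals make the pieces fit without overlap.\<close>

lemma nn_integral_periodic_shift:
  fixes g :: "real \<Rightarrow> ennreal"
  assumes g [measurable]: "g \<in> borel_measurable borel" and per: "\<And>t. g (t + p) = g t"
    and \<alpha>: "0 \<le> \<alpha>" "\<alpha> \<le> p"
  shows "(\<integral>\<^sup>+t. g (\<alpha> + t) * indicator {0..<p} t \<partial>lborel) = (\<integral>\<^sup>+t. g t * indicator {0..<p} t \<partial>lborel)"
proof -
  have "(\<integral>\<^sup>+t. g (\<alpha> + t) * indicator {0..<p} t \<partial>lborel)
      = (\<integral>\<^sup>+t. g t * indicator {\<alpha>..<\<alpha> + p} t \<partial>lborel)"
    by (subst nn_integral_real_affine[of "\<lambda>t. g t * indicator {\<alpha>..<\<alpha> + p} t" 1 \<alpha>])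
       (auto intro!: nn_integral_cong simp: indicator_def)
  also have "\<dots> = (\<integral>\<^sup>+t. g t * indicator {\<alpha>..<p} t + g t * indicator {p..<\<alpha> + p} t \<partial>lborel)"
    using \<alpha> by (intro nn_integral_cong) (auto simp: indicator_def)
  also have "\<dots> = (\<integral>\<^sup>+t. g t * indicator {\<alpha>..<p} t \<partial>lborel) + (\<integral>\<^sup>+t. g t * indicator {p..<\<alpha> + p} t \<partial>lborel)"
    by (intro nn_integral_add) measurable
  also have "(\<integral>\<^sup>+t. g t * indicator {p..<\<alpha> + p} t \<partial>lborel) = (\<integral>\<^sup>+t. g t * indicator {0..<\<alpha>} t \<partial>lborel)"
    by (subst nn_integral_real_affine[of "\<lambda>t. g t * indicator {p..<\<alpha> + p} t" 1 p])
       (auto intro!: nn_integral_cong simp: indicator_def per add.commute)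
  also have "(\<integral>\<^sup>+t. g t * indicator {\<alpha>..<p} t \<partial>lborel) + (\<integral>\<^sup>+t. g t * indicator {0..<\<alpha>} t \<partial>lborel)
      = (\<integral>\<^sup>+t. g t * indicator {\<alpha>..<p} t + g t * indicator {0..<\<alpha>} t \<partial>lborel)"
    by (intro nn_integral_add[symmetric]) measurable
  also have "\<dots> = (\<integral>\<^sup>+t. g t * indicator {0..<p} t \<partial>lborel)"
    using \<alpha> by (intro nn_integral_cong) (auto simp: indicator_def)
  finally show ?thesis .
qed

text \<open>Averaging over rotations replaces polar coordinates.\<close>

lemma nn_integral_radial_le:
  fixes F k :: "complex \<Rightarrow> ennreal"
  assumes [measurable]: "F \<in> borel_measurable borel" "k \<in> borel_measurable borel"
    and radial: "\<And>t z. k (cis t * z) = k z"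
    and circle: "\<And>z. k z \<noteq> 0 \<Longrightarrow>
      (\<integral>\<^sup>+t. F (w + of_real (cmod z) * cis t) * indicator {0..<2 * pi} t \<partial>lborel) \<le> ennreal (2 * pi) * C"
  shows "(\<integral>\<^sup>+z. F (w + z) * k z \<partial>lborel) \<le> C * (\<integral>\<^sup>+z. k z \<partial>lborel)"
proof -
  have inner: "(\<integral>\<^sup>+t. F (w + cis t * z) * indicator {0..<2 * pi} t \<partial>lborel) \<le> ennreal (2 * pi) * C"
    if "k z \<noteq> 0" for z
  proof -
    \<comment> \<open>Rotating \<open>z\<close> through a full turn runs once around the circle of
      radius \<open>cmod z\<close>, starting at the argument \<open>\<alpha>\<close>; periodicity
      moves the start to 0.\<close>
    obtain \<alpha> where \<alpha>: "0 \<le> \<alpha>" "\<alpha> \<le> 2 * pi" "z = of_real (cmod z) * cis \<alpha>"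
      using Arg2pi_eq[of z] Arg2pi_ge_0[of z] Arg2pi_lt_2pi[of z] by (force simp: cis_conv_exp)
    have "cis t * z = of_real (cmod z) * cis (\<alpha> + t)" for t
      by (subst (1) \<alpha>(3)) (simp add: cis_mult[symmetric] mult_ac)
    then have "(\<integral>\<^sup>+t. F (w + cis t * z) * indicator {0..<2 * pi} t \<partial>lborel)
        = (\<integral>\<^sup>+t. F (w + of_real (cmod z) * cis (\<alpha> + t)) * indicator {0..<2 * pi} t \<partial>lborel)"
      by simp
    also have "\<dots> = (\<integral>\<^sup>+t. F (w + of_real (cmod z) * cis t) * indicator {0..<2 * pi} t \<partial>lborel)"
    proof (rule nn_integral_periodic_shift[where g = "\<lambda>t. F (w + of_real (cmod z) * cis t)"])
      have "cis \<in> borel_measurable borel"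
        by (intro borel_measurable_continuous_onI continuous_intros)
      then show "(\<lambda>t. F (w + of_real (cmod z) * cis t)) \<in> borel_measurable borel"
        by measurable
      show "F (w + of_real (cmod z) * cis (t + 2 * pi)) = F (w + of_real (cmod z) * cis t)" for t
        by (simp add: cis_mult[symmetric])
    qed (use \<alpha> in auto)
    finally show ?thesis using circle[OF that] by simp
  qed
  have [measurable]: "cis \<in> borel_measurable borel"
    by (intro borel_measurable_continuous_onI continuous_intros)
  have "ennreal (2 * pi) * (\<integral>\<^sup>+z. F (w + z) * k z \<partial>lborel)
      = (\<integral>\<^sup>+t. (\<integral>\<^sup>+z. F (w + z) * k z \<partial>lborel) * indicator {0..<2 * pi} t \<partial>lborel)"
    by (subst nn_integral_cmult_indicator) (auto simp: mult.commute)
  also have "\<dots> = (\<integral>\<^sup>+t. (\<integral>\<^sup>+z. F (w + cis t * z) * k z \<partial>lborel) * indicator {0..<2 * pi} t \<partial>lborel)"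
  proof -
    have "(\<integral>\<^sup>+z. F (w + cis t * z) * k z \<partial>lborel) = (\<integral>\<^sup>+z. F (w + z) * k z \<partial>lborel)" for t
      using nn_integral_rotate[of "\<lambda>z. F (w + z) * k z" t] by (simp add: radial)
    then show ?thesis by simp
  qed
  also have "\<dots> = (\<integral>\<^sup>+t. \<integral>\<^sup>+z. F (w + cis t * z) * k z * indicator {0..<2 * pi} t \<partial>lborel \<partial>lborel)"
    by (subst nn_integral_multc) auto
  also have "\<dots> = (\<integral>\<^sup>+z. \<integral>\<^sup>+t. F (w + cis t * z) * k z * indicator {0..<2 * pi} t \<partial>lborel \<partial>lborel)"
    by (rule lborel_pair.Fubini') measurable
  also have "\<dots> = (\<integral>\<^sup>+z. (\<integral>\<^sup>+t. F (w + cis t * z) * indicator {0..<2 * pi} t \<partial>lborel) * k z \<partial>lborel)"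
    by (subst nn_integral_multc[symmetric]) (auto simp: mult_ac)
  also have "\<dots> \<le> (\<integral>\<^sup>+z. ennreal (2 * pi) * C * k z \<partial>lborel)"
  proof (rule nn_integral_mono)
    fix z
    \<comment> \<open>The circle bound is available only where \<open>k\<close> is nonzero;
      elsewhere both sides are 0.\<close>
    show "(\<integral>\<^sup>+t. F (w + cis t * z) * indicator {0..<2 * pi} t \<partial>lborel) * k z \<le> ennreal (2 * pi) * C * k z"
      using inner[of z] by (cases "k z = 0") (auto intro: mult_right_mono)
  qed
  also have "\<dots> = ennreal (2 * pi) * (C * (\<integral>\<^sup>+z. k z \<partial>lborel))"
    by (subst nn_integral_cmult) (auto simp: mult_ac)
  finally show ?thesis
    by (subst (asm) ennreal_mult_le_mult_iff) auto
qed

text \<open>The preimage of the half-line up to \<open>a \<ge> 0\<close> is the closed disc of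
  radius \<open>\<delta> * sqrt a\<close>, whose area is linear in \<open>a\<close>; so the image
  measure has constant density on the nonnegative half-line. Half-lines determine the
  measure.\<close>

lemma distr_sq_dist_lborel:
  assumes "\<delta> > 0"
  shows "distr lborel borel (sq_dist w \<delta>) = density lborel (\<lambda>s. ennreal (pi * \<delta>\<^sup>2) * indicator {0..} s)"
proof (rule measure_eqI_generator_eq[where E = "range (\<lambda>a::real. {..a})" and \<Omega> = UNIV and A = "\<lambda>i. {..real i}"])
  have [measurable]: "sq_dist w \<delta> \<in> borel_measurable borel"
    using C_k_on_imp_continuous_on[OF C_k_on_sq_dist] by (rule borel_measurable_continuous_onI)
  have em: "emeasure (distr lborel borel (sq_dist w \<delta>)) {..a} = ennreal (pi * \<delta>\<^sup>2 * max 0 a)" for a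
  proof (cases "a \<ge> 0")
    case True
    have "sq_dist w \<delta> z \<le> a \<longleftrightarrow> (cmod (z - w))\<^sup>2 \<le> (\<delta> * sqrt a)\<^sup>2" for z
      using assms True by (simp add: sq_dist_def field_simps)
    also have "\<dots> z \<longleftrightarrow> z \<in> cball w (\<delta> * sqrt a)" for z
      using assms True by (simp add: dist_norm norm_minus_commute abs_le_square_iff[symmetric])
    finally have "sq_dist w \<delta> -` {..a} = cball w (\<delta> * sqrt a)" by auto
    then have "emeasure (distr lborel borel (sq_dist w \<delta>)) {..a} = emeasure lborel (cball w (\<delta> * sqrt a))"
      by (subst emeasure_distr) auto
    also have "\<dots> = ennreal (pi * (\<delta> * sqrt a)\<^sup>2)"
      using assms True by (subst emeasure_cball) (auto simp: unit_ball_vol_2)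
    finally show ?thesis using True by (simp add: power_mult_distrib mult.assoc)
  next
    case False
    moreover have "sq_dist w \<delta> z \<ge> 0" for z by (simp add: sq_dist_def)
    ultimately have "sq_dist w \<delta> -` {..a} = {}" by (auto simp: not_le) (meson le_less_trans not_le)
    then show ?thesis using False by (subst emeasure_distr) (auto simp: max_def)
  qed
  show "emeasure (distr lborel borel (sq_dist w \<delta>)) X =
      emeasure (density lborel (\<lambda>s. ennreal (pi * \<delta>\<^sup>2) * indicator {0..} s)) X"
    if X_range: "X \<in> range (\<lambda>a::real. {..a})" for X
  proof -
    obtain a where X: "X = {..a}" using X_range by auto
    have "emeasure (density lborel (\<lambda>s. ennreal (pi * \<delta>\<^sup>2) * indicator {0..} s)) {..a}
        = (\<integral>\<^sup>+s. ennreal (pi * \<delta>\<^sup>2) * indicator {0..a} s \<partial>lborel)"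
      by (subst emeasure_density) (auto intro!: nn_integral_cong simp: indicator_def)
    also have "\<dots> = ennreal (pi * \<delta>\<^sup>2) * ennreal (max 0 a)"
      by (subst nn_integral_cmult_indicator) (auto simp: max_def)
    also have "\<dots> = ennreal (pi * \<delta>\<^sup>2 * max 0 a)"
      by (simp add: ennreal_mult)
    finally show ?thesis using em X by simp
  qed
  show "emeasure (distr lborel borel (sq_dist w \<delta>)) {..real i} \<noteq> \<infinity>" for i
    using em by simp
  show "sets (distr lborel borel (sq_dist w \<delta>)) = sigma_sets UNIV (range (\<lambda>a::real. {..a}))"
    by (subst sets_distr, subst borel_eq_atMost, subst sets_measure_of) auto
  show "sets (density lborel (\<lambda>s. ennreal (pi * \<delta>\<^sup>2) * indicator {0..} s)) = sigma_sets UNIV (range (\<lambda>a::real. {..a}))"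
    by (subst sets_density, subst sets_lborel, subst borel_eq_atMost, subst sets_measure_of) auto
  show "(\<Union>i. {..real i}) = UNIV"
    by (auto simp: real_arch_simple)
qed (auto simp: Int_stable_def)

context log_profile
begin

lemma nn_integral_bump:
  assumes "\<delta> > 0"
  shows "(\<integral>\<^sup>+z. ennreal (bump w \<delta> z) \<partial>lborel) = 1"
proof -
  have q [measurable]: "sq_dist w \<delta> \<in> borel_measurable borel"
    using C_k_on_imp_continuous_on[OF C_k_on_sq_dist] by (rule borel_measurable_continuous_onI)
  note b_measurable [measurable]
  have "(\<integral>\<^sup>+z. ennreal (bump w \<delta> z) \<partial>lborel)
      = (\<integral>\<^sup>+z. ennreal (1 / (pi * \<delta>\<^sup>2)) * ennreal (b (sq_dist w \<delta> z)) \<partial>lborel)"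
    by (intro nn_integral_cong) (simp add: bump_def ennreal_mult'[symmetric] b_nonneg)
  also have "\<dots> = ennreal (1 / (pi * \<delta>\<^sup>2)) * (\<integral>\<^sup>+s. ennreal (b s) \<partial>distr lborel borel (sq_dist w \<delta>))"
    by (subst nn_integral_cmult, simp, subst nn_integral_distr) auto
  also have "\<dots> = ennreal (1 / (pi * \<delta>\<^sup>2)) * (\<integral>\<^sup>+s. ennreal (pi * \<delta>\<^sup>2) * indicator {0..} s * ennreal (b s) \<partial>lborel)"
    by (subst distr_sq_dist_lborel[OF assms], subst nn_integral_density) auto
  also have "(\<integral>\<^sup>+s. ennreal (pi * \<delta>\<^sup>2) * indicator {0..} s * ennreal (b s) \<partial>lborel)
      = (\<integral>\<^sup>+s. ennreal (pi * \<delta>\<^sup>2) * ennreal (b s) \<partial>lborel)"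
  proof (intro nn_integral_cong)
    fix s
    show "ennreal (pi * \<delta>\<^sup>2) * indicator {0..} s * ennreal (b s) = ennreal (pi * \<delta>\<^sup>2) * ennreal (b s)"
      using b_support[of s] by (cases "b s = 0") (auto simp: indicator_def)
  qed
  also have "\<dots> = ennreal (pi * \<delta>\<^sup>2)"
    by (subst nn_integral_cmult) (auto simp: b_integral)
  also have "ennreal (1 / (pi * \<delta>\<^sup>2)) * ennreal (pi * \<delta>\<^sup>2) = 1"
    using assms by (simp add: ennreal_mult'[symmetric])
  finally show ?thesis .
qed

lemma bump_rotate: "bump 0 \<delta> (cis t * z) = bump 0 \<delta> z"
  by (simp add: bump_def sq_dist_def norm_mult)

end

section \<open>Extended-real integrals whose value may be negative infinite\<close>

lemma ereal_integral_diff: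
  fixes F :: "'a \<Rightarrow> ennreal"
  assumes g: "integrable M g" and F [measurable]: "F \<in> borel_measurable M"
    and f: "\<And>x. x \<in> space M \<Longrightarrow> f x = ereal (g x) - enn2ereal (F x)"
  shows "ereal_integral M f = ereal (\<integral>x. g x \<partial>M) - enn2ereal (\<integral>\<^sup>+x. F x \<partial>M)"
proof -
  have gm [measurable]: "g \<in> borel_measurable M" using g by simp
  let ?f = "\<lambda>x. ereal (g x) - enn2ereal (F x)"
  define P N where "P = (\<integral>\<^sup>+x. e2ennreal (?f x) \<partial>M)" and "N = (\<integral>\<^sup>+x. e2ennreal (- ?f x) \<partial>M)"
  have PN: "ereal_integral M f = enn2ereal P - enn2ereal N"
    unfolding ereal_integral_def P_def N_def using f by (simp cong: nn_integral_cong)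
  \<comment> \<open>With f = g - F and positive and negative parts written f+ and f-, this is f+ + F
    + g- = f- + g+. All terms are added and none subtracted, so it also holds where
    \<open>F x\<close> is infinite.\<close>
  have pt: "e2ennreal (?f x) + F x + ennreal (- g x) = e2ennreal (- ?f x) + ennreal (g x)" for x
  proof (cases "F x")
    case (real r)
    then show ?thesis
      by (cases "g x \<ge> 0"; cases "g x \<ge> r")
         (auto simp: enn2ereal_ennreal e2ennreal_ereal ennreal_plus[symmetric] ennreal_neg simp del: ennreal_plus)
  next
    case top
    then show ?thesis by simp
  qed
  have "P + (\<integral>\<^sup>+x. F x \<partial>M) + (\<integral>\<^sup>+x. ennreal (- g x) \<partial>M)
      = (\<integral>\<^sup>+x. e2ennreal (?f x) + F x + ennreal (- g x) \<partial>M)"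
    unfolding P_def by (simp add: nn_integral_add)
  also have "\<dots> = N + (\<integral>\<^sup>+x. ennreal (g x) \<partial>M)"
    unfolding pt N_def by (simp add: nn_integral_add)
  finally have eq: "P + (\<integral>\<^sup>+x. F x \<partial>M) + (\<integral>\<^sup>+x. ennreal (- g x) \<partial>M) = N + (\<integral>\<^sup>+x. ennreal (g x) \<partial>M)" .
  have gfin: "(\<integral>\<^sup>+x. ennreal (g x) \<partial>M) < \<infinity>" "(\<integral>\<^sup>+x. ennreal (- g x) \<partial>M) < \<infinity>"
    using g by (auto simp: real_integrable_def less_top)
  \<comment> \<open>The positive part is finite, so \<open>P\<close> minus \<open>N\<close> is never
    \<infinity> - \<infinity>, even if \<open>N\<close> is infinite.\<close>
  have "P \<le> (\<integral>\<^sup>+x. ennreal (g x) \<partial>M)"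
    unfolding P_def
  proof (intro nn_integral_mono)
    fix x
    have "?f x \<le> ereal (g x)" by (cases "F x") (auto simp: enn2ereal_ennreal)
    then show "e2ennreal (?f x) \<le> ennreal (g x)"
      by (metis e2ennreal_ereal e2ennreal_mono)
  qed
  then have "P < \<infinity>" using gfin(1) by (rule le_less_trans)
  then obtain p where p: "P = ennreal p" "p \<ge> 0" by (cases P) auto
  obtain gp where gp: "(\<integral>\<^sup>+x. ennreal (g x) \<partial>M) = ennreal gp" "gp \<ge> 0"
    using gfin(1) by (cases "\<integral>\<^sup>+x. ennreal (g x) \<partial>M") auto
  obtain gn where gn: "(\<integral>\<^sup>+x. ennreal (- g x) \<partial>M) = ennreal gn" "gn \<ge> 0"
    using gfin(2) by (cases "\<integral>\<^sup>+x. ennreal (- g x) \<partial>M") auto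
  have ig: "(\<integral>x. g x \<partial>M) = gp - gn"
    using real_lebesgue_integral_def[OF g] gp gn by simp
  show ?thesis
  proof (cases "\<integral>\<^sup>+x. F x \<partial>M")
    case (real r)
    then have "N + ennreal gp = ennreal (p + r + gn)"
      using eq p gp gn by simp
    moreover from this obtain n where n: "N = ennreal n" "n \<ge> 0"
      by (cases N) (auto simp: top_add)
    ultimately have "n + gp = p + r + gn"
      using p gp gn real by (simp add: ennreal_plus[symmetric] del: ennreal_plus)
    then show ?thesis
      using p n real by (simp add: PN ig enn2ereal_ennreal)
  next
    case top
    then have "N + ennreal gp = \<infinity>" using eq gp by simp
    then have "N = \<infinity>" by (cases N) (simp_all add: ennreal_plus[symmetric] gp(2) del: ennreal_plus)
    then show ?thesis using p top by (simp add: PN enn2ereal_ennreal)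
  qed
qed

text \<open>An infinite positive part gives the value \<infinity>, whatever the negative part, and
  an infinite negative part with a finite positive one gives -\<infinity>. A real value thus forces
  absolute convergence. Since the defining equation of the generalised Laplacian has a real left
  side, integrability can be read off from it.\<close>

lemma ereal_integral_eq_real:
  assumes f [measurable]: "f \<in> borel_measurable M" and a: "ereal_integral M f = ereal a"
  shows "(\<integral>\<^sup>+x. e2ennreal \<bar>f x\<bar> \<partial>M) < \<infinity>" "AE x in M. \<bar>f x\<bar> \<noteq> \<infinity>"
    "integrable M (\<lambda>x. real_of_ereal (f x))" "(\<integral>x. real_of_ereal (f x) \<partial>M) = a"
proof -
  define P N where "P = (\<integral>\<^sup>+x. e2ennreal (f x) \<partial>M)" and "N = (\<integral>\<^sup>+x. e2ennreal (- f x) \<partial>M)"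
  have PN: "enn2ereal P - enn2ereal N = ereal a"
    using a by (simp add: ereal_integral_def P_def N_def)
  have fin: "P < \<infinity>" "N < \<infinity>"
    using PN by (cases P; cases N; auto simp: enn2ereal_ennreal)+
  have "(\<integral>\<^sup>+x. e2ennreal \<bar>f x\<bar> \<partial>M) = (\<integral>\<^sup>+x. e2ennreal (f x) + e2ennreal (- f x) \<partial>M)"
  proof (intro nn_integral_cong)
    fix x
    show "e2ennreal \<bar>f x\<bar> = e2ennreal (f x) + e2ennreal (- f x)"
      by (cases "f x"; cases "f x \<ge> 0") (auto simp: e2ennreal_ereal ennreal_neg)
  qed
  also have "\<dots> = P + N"
    unfolding P_def N_def by (intro nn_integral_add) measurable
  finally show f1: "(\<integral>\<^sup>+x. e2ennreal \<bar>f x\<bar> \<partial>M) < \<infinity>"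
    using fin by simp
  have "AE x in M. e2ennreal \<bar>f x\<bar> \<noteq> \<infinity>"
    by (rule nn_integral_noteq_infinite) (use f1 in auto)
  then show ae: "AE x in M. \<bar>f x\<bar> \<noteq> \<infinity>"
    by eventually_elim (auto simp: e2ennreal_infty)
  have P': "(\<integral>\<^sup>+x. ennreal (real_of_ereal (f x)) \<partial>M) = P"
    unfolding P_def by (rule nn_integral_cong_AE) (use ae in \<open>eventually_elim, auto simp: e2ennreal_ereal\<close>)
  have N': "(\<integral>\<^sup>+x. ennreal (- real_of_ereal (f x)) \<partial>M) = N"
    unfolding N_def by (rule nn_integral_cong_AE) (use ae in \<open>eventually_elim, auto simp: e2ennreal_ereal\<close>)
  show i: "integrable M (\<lambda>x. real_of_ereal (f x))"
    unfolding real_integrable_def P' N' using fin by auto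
  obtain p where p: "P = ennreal p" "p \<ge> 0" using fin by (cases P) auto
  obtain n where n: "N = ennreal n" "n \<ge> 0" using fin by (cases N) auto
  show "(\<integral>x. real_of_ereal (f x) \<partial>M) = a"
    using PN unfolding real_lebesgue_integral_def[OF i] P' N' using p n by (simp add: enn2ereal_ennreal)
qed

text \<open>Passing to F = M - u turns the sub-mean inequality into an upper bound for the integral
  of a nonnegative function. The points where u is -\<infinity> become points where \<open>F\<close>
  is infinite, and Tonelli's theorem can be used afterwards.\<close>

lemma circle_mean_bound:
  fixes M :: real
  assumes le: "u w \<le> circle_mean u w r"
    and uM: "\<And>z. z \<in> cball w r \<Longrightarrow> u z \<le> ereal M" and r: "r \<ge> 0"
    and meas: "(\<lambda>t. F (w + of_real r * cis t)) \<in> borel_measurable borel"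
    and F: "\<And>z. z \<in> cball w r \<Longrightarrow> F z = e2ennreal (ereal M - u z)"
  shows "(\<integral>\<^sup>+t. F (w + of_real r * cis t) * indicator {0..<2 * pi} t \<partial>lborel) \<le> ennreal (2 * pi) * F w"
proof -
  let ?R = "restrict_space lborel {0..2 * pi}"
  let ?I = "\<integral>\<^sup>+t. F (w + of_real r * cis t) \<partial>?R"
  have c: "w + of_real r * cis t \<in> cball w r" for t
    using r by (simp add: dist_norm norm_mult)
  have u: "u z = ereal M - enn2ereal (F z)" if "z \<in> cball w r" for z
    using uM[OF that] F[OF that] by (cases "u z") (auto simp: enn2ereal_ennreal e2ennreal_ereal)
  have int: "integrable ?R (\<lambda>_. M)"
    by (subst integrable_restrict_space) (auto simp: set_integrable_def)
  have "ereal_integral ?R (\<lambda>t. u (w + of_real r * cis t)) = ereal (\<integral>t. M \<partial>?R) - enn2ereal ?I"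
    using meas by (intro ereal_integral_diff int u c) (auto intro: measurable_restrict_space1)
  also have "(\<integral>t. M \<partial>?R) = 2 * pi * M"
    by (simp add: measure_restrict_space space_restrict_space)
  finally have le': "u w \<le> ereal (1 / (2 * pi)) * (ereal (2 * pi * M) - enn2ereal ?I)"
    using le by (simp add: circle_mean_def)
  have w: "w \<in> cball w r" using r by simp
  have "?I \<le> ennreal (2 * pi) * F w"
  proof (cases "F w")
    case (real s)
    then have uw: "u w = ereal (M - s)" using u[OF w] by (simp add: enn2ereal_ennreal)
    show ?thesis
    proof (cases ?I)
      case (real i)
      then have "M - s \<le> 1 / (2 * pi) * (2 * pi * M - i)"
        using le' uw by (simp add: enn2ereal_ennreal)
      then have "i \<le> 2 * pi * s"
        by (simp add: field_simps)
      then show ?thesis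
        using real \<open>F w = ennreal s\<close> \<open>0 \<le> s\<close> by (simp add: ennreal_mult'[symmetric])
    next
      case top
      then have "u w \<le> - \<infinity>" using le' by simp
      then show ?thesis using uw by simp
    qed
  next
    case top
    then show ?thesis by (simp add: ennreal_mult_top)
  qed
  moreover have "?I = (\<integral>\<^sup>+t. F (w + of_real r * cis t) * indicator {0..2 * pi} t \<partial>lborel)"
    by (rule nn_integral_restrict_space) auto
  moreover have "(\<integral>\<^sup>+t. F (w + of_real r * cis t) * indicator {0..<2 * pi} t \<partial>lborel)
      \<le> (\<integral>\<^sup>+t. F (w + of_real r * cis t) * indicator {0..2 * pi} t \<partial>lborel)"
    by (intro nn_integral_mono) (auto simp: indicator_def)
  ultimately show ?thesis by simp
qed

section \<open>The decomposition\<close>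

lemma partial_diff:
  assumes "f differentiable (at z)" "g differentiable (at z)"
  shows "partial v (\<lambda>z. f z - g z) z = partial v f z - partial v g z"
  by (rule partial_eq_derivative, rule has_derivative_diff; rule has_derivative_partial; fact)

lemma C_2_differentiable:
  assumes "C_k_on 2 UNIV f"
  shows "f differentiable (at z)" "partial 1 f differentiable (at z)" "partial \<i> f differentiable (at z)"
  using assms by (auto simp: numeral_2_eq_2)

lemma laplacian_diff:
  assumes "C_k_on 2 UNIV f" "C_k_on 2 UNIV g"
  shows "laplacian (\<lambda>z. f z - g z) z = laplacian f z - laplacian g z"
proof -
  have "partial v (\<lambda>z. f z - g z) = (\<lambda>z. partial v f z - partial v g z)" for v
    by (rule ext, rule partial_diff) (use assms C_2_differentiable in auto)
  then show ?thesis
    unfolding laplacian_def using C_2_differentiable[OF assms(1)] C_2_differentiable[OF assms(2)]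
    by (simp add: partial_diff)
qed

lemma laplacian_cong:
  assumes "open S" "z \<in> S" "\<And>x. x \<in> S \<Longrightarrow> f x = g x"
  shows "laplacian f z = laplacian g z"
proof -
  have "partial v (partial v f) z = partial v (partial v g) z" for v
    by (rule partial_cong[OF assms(1,2)], rule partial_cong[OF assms(1)]) (use assms(3) in auto)
  then show ?thesis by (simp add: laplacian_def)
qed

lemma partial_reflect:
  assumes "\<And>z. f differentiable (at z)"
  shows "partial v (\<lambda>z. f (w - z)) = (\<lambda>z. - partial v f (w - z))"
proof
  fix z
  have "((\<lambda>z. w - z) has_derivative (\<lambda>v. - v)) (at z)"
    by (auto intro!: derivative_eq_intros)
  from has_derivative_compose[OF this has_derivative_partial[OF assms]]
  have "((\<lambda>z. f (w - z)) has_derivative (\<lambda>v. partial (- v) f (w - z))) (at z)" .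
  then have "partial v (\<lambda>z. f (w - z)) z = partial (- v) f (w - z)"
    by (rule partial_eq_derivative)
  also have "\<dots> = - partial v f (w - z)"
    using linear_neg[OF has_derivative_linear[OF has_derivative_partial[OF assms]]] .
  finally show "partial v (\<lambda>z. f (w - z)) z = - partial v f (w - z)" .
qed

lemma laplacian_reflect:
  assumes "C_k_on 2 UNIV f"
  shows "laplacian (\<lambda>z. f (w - z)) z = laplacian f (w - z)"
proof -
  have d: "(\<lambda>z. - partial v f z) differentiable (at z)" if "v = 1 \<or> v = \<i>" for v z
    using C_2_differentiable[OF assms] that by auto
  have "partial v (\<lambda>z. - partial v f z) z = - partial v (partial v f) z" if "v = 1 \<or> v = \<i>" for v z
    by (rule partial_eq_derivative, rule has_derivative_minus, rule has_derivative_partial)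
       (use C_2_differentiable[OF assms] that in auto)
  then show ?thesis
    unfolding laplacian_def partial_reflect[OF C_2_differentiable(1)[OF assms]]
    using partial_reflect[of "\<lambda>z. - partial 1 f z" 1 w] partial_reflect[of "\<lambda>z. - partial \<i> f z" \<i> w] d
    by simp
qed

lemma bounded_subset_cball_0: "bounded S \<Longrightarrow> \<exists>R. S \<subseteq> cball (0::complex) R"
  by (meson bounded_subset_ballD ball_subset_cball order_trans)

lemma test_functionI:
  assumes "\<And>k. C_k_on k UNIV \<phi>" "{z. \<phi> z \<noteq> 0} \<subseteq> cball w \<delta>" "cball w \<delta> \<subseteq> D"
  shows "test_function D \<phi>"
proof -
  have "closure {z. \<phi> z \<noteq> 0} \<subseteq> cball w \<delta>"
    using assms(2) by (rule closure_minimal) simp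
  moreover from this have "compact (closure {z. \<phi> z \<noteq> 0})"
    using bounded_subset[OF bounded_cball] by (simp add: compact_eq_bounded_closed)
  ultimately show ?thesis
    using assms by (auto simp: test_function_def)
qed

lemma continuous_on_laplacian:
  assumes "C_k_on 2 UNIV f"
  shows "continuous_on UNIV (laplacian f)"
  using assms unfolding laplacian_def[abs_def]
  by (auto simp: numeral_2_eq_2 intro!: continuous_on_add)

context log_profile
begin

text \<open>The nonnegative function \<open>L_\<delta> - log\<close>, centred at \<open>w\<close>.
  The separate value at the centre, where \<open>ln 0\<close> is an arbitrary real, makes the
  logarithm, taken as -\<infinity> there, equal to \<open>smooth_log\<close> minus
  \<open>log_excess\<close> at every point.\<close>

definition log_excess :: "complex \<Rightarrow> real \<Rightarrow> complex \<Rightarrow> ennreal" where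
  "log_excess w \<delta> z = (if z = w then \<infinity> else ennreal (smooth_log w \<delta> z - ln (cmod (z - w))))"

lemma borel_measurable_log_excess: "\<delta> > 0 \<Longrightarrow> log_excess w \<delta> \<in> borel_measurable borel"
  unfolding log_excess_def[abs_def] using borel_measurable_smooth_log[of \<delta> w] by measurable

lemma log_excess_eq_0: "\<delta> > 0 \<Longrightarrow> \<delta> \<le> cmod (z - w) \<Longrightarrow> log_excess w \<delta> z = 0"
  by (auto simp: log_excess_def smooth_log_eq_ln)

text \<open>At the centre the difference is ln \<delta> - ln (\<delta> / 2^n) = n ln 2, which tends
  to infinity; elsewhere the sequence is constant as soon as \<delta> / 2^n is below |z -
  w|.\<close>

lemma LIMSEQ_log_excess:
  assumes "\<delta> > 0"
  shows "(\<lambda>n. ennreal (smooth_log w \<delta> z - smooth_log w (\<delta> / 2 ^ n) z)) \<longlonglongrightarrow> log_excess w \<delta> z"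
proof (cases "z = w")
  case True
  have "smooth_log w \<delta> z - smooth_log w (\<delta> / 2 ^ n) z = real n * ln 2" for n
    using assms True by (simp add: smooth_log_def sq_dist_def ln_div ln_realpow)
  moreover have "filterlim (\<lambda>n. real n * ln 2) at_top sequentially"
    by (intro filterlim_at_top_mult_tendsto_pos[OF tendsto_const] filterlim_real_sequentially) simp
  then have "(\<lambda>n. ennreal (real n * ln 2)) \<longlonglongrightarrow> \<infinity>"
    by (simp add: ennreal_tendsto_top_eq_at_top)
  ultimately show ?thesis using True by (simp add: log_excess_def)
next
  case False
  have "(\<lambda>n. \<delta> * (1 / 2) ^ n) \<longlonglongrightarrow> \<delta> * 0"
    by (intro tendsto_mult tendsto_const LIMSEQ_power_zero) simp
  then have "\<forall>\<^sub>F n in sequentially. \<delta> * (1 / 2) ^ n < cmod (z - w)"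
    using False by (intro order_tendstoD(2)) auto
  then have "\<forall>\<^sub>F n in sequentially. log_excess w \<delta> z = ennreal (smooth_log w \<delta> z - smooth_log w (\<delta> / 2 ^ n) z)"
  proof eventually_elim
    case (elim n)
    then show ?case
      using assms False smooth_log_eq_ln[of "\<delta> / 2 ^ n" z w]
      by (simp add: log_excess_def power_divide)
  qed
  then show ?thesis by (rule tendsto_eventually[OF eventually_mono]) simp
qed

end

section \<open>Local integrability, pointwise limits of the means, and the formula on a single
  disc\<close>

locale subharmonic_riesz = log_profile +
  fixes D :: "complex set" and u :: "complex \<Rightarrow> ereal" and \<nu> :: "complex measure"
  assumes subharmonic: "subharmonic_on D u"
    and laplacian: "is_generalised_laplacian D u \<nu>"
begin

lemma open_D: "open D"
  and u_not_PInf: "z \<in> D \<Longrightarrow> u z \<noteq> \<infinity>"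
  and open_u_less: "open {z \<in> D. u z < c}"
  using subharmonic openin_open_trans unfolding subharmonic_on_def usc_on_def by auto

text \<open>A real-valued version of \<open>u\<close> for Bochner integrals. It is 0 where
  \<open>u\<close> is -\<infinity>; this alters no integral over a compact part of \<open>D\<close>
  once those points are known to form a null set there.\<close>

definition v :: "complex \<Rightarrow> real" where
  "v z = (if z \<in> D then real_of_ereal (u z) else 0)"

lemma D_borel [measurable]: "D \<in> sets borel"
  using open_D by simp

lemma u_measurable: "u \<in> borel_measurable (restrict_space lborel D)"
proof -
  have "u -` {..<a} \<inter> space (restrict_space lborel D) \<in> sets (restrict_space lborel D)" for a
  proof -
    have "u -` {..<a} \<inter> space (restrict_space lborel D) = {z \<in> D. u z < a}"
      by (auto simp: space_restrict_space)
    moreover have "{z \<in> D. u z < a} \<in> sets borel"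
      using open_u_less by simp
    ultimately show ?thesis
      by (auto simp: sets_restrict_space_iff)
  qed
  then show ?thesis
    by (simp add: borel_measurable_ereal_iff_Iio)
qed

lemma u_measurable': "(\<lambda>z. if z \<in> D then u z else 0) \<in> borel_measurable borel"
proof -
  have "(\<lambda>z. if z \<in> D then u z else 0) \<in> borel_measurable lborel"
    using u_measurable by (subst (asm) measurable_restrict_space_iff[where c = 0]) auto
  then show ?thesis by simp
qed

lemma v_measurable [measurable]: "v \<in> borel_measurable borel"
proof -
  have "v = (\<lambda>z. real_of_ereal (if z \<in> D then u z else 0))"
    by (auto simp: v_def)
  then show ?thesis using u_measurable' by simp
qed

lemma sets_\<nu>: "sets \<nu> = sets (restrict_space borel D)"
  and finite_\<nu>: "compact C \<Longrightarrow> C \<subseteq> D \<Longrightarrow> emeasure \<nu> C < \<infinity>"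
  using laplacian by (auto simp: is_generalised_laplacian_def radon_measure_on_def)

lemma space_\<nu>: "space \<nu> = D"
  using sets_eq_imp_space_eq[OF sets_\<nu>] by (simp add: space_restrict_space)

lemma id_measurable_\<nu> [measurable]: "(\<lambda>z. z) \<in> measurable \<nu> borel"
  by (subst measurable_cong_sets[OF sets_\<nu> refl]) (rule measurable_restrict_space1, simp)

lemma borel_measurable_\<nu>: "f \<in> measurable borel N \<Longrightarrow> f \<in> measurable \<nu> N"
  by (subst measurable_cong_sets[OF sets_\<nu> refl]) (rule measurable_restrict_space1)

lemma in_sets_\<nu>: "S \<in> sets borel \<Longrightarrow> S \<subseteq> D \<Longrightarrow> S \<in> sets \<nu>"
  by (auto simp: sets_\<nu> sets_restrict_space_iff)

lemma integrable_indicator_\<nu>: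
  assumes "S \<in> sets borel" "S \<subseteq> C" "compact C" "C \<subseteq> D"
  shows "integrable \<nu> (\<lambda>z. indicator S z / (2 * pi) :: real)"
proof -
  have C: "C \<in> sets \<nu>" using assms by (auto intro!: in_sets_\<nu> compact_imp_closed borel_closed)
  have "emeasure \<nu> S \<le> emeasure \<nu> C"
    using assms C by (intro emeasure_mono) auto
  then have "emeasure \<nu> S < \<infinity>"
    using finite_\<nu>[OF assms(3,4)] by (rule le_less_trans)
  moreover have "S \<in> sets \<nu>" using assms by (intro in_sets_\<nu>) auto
  ultimately have "integrable \<nu> (indicator S :: complex \<Rightarrow> real)"
    by (intro integrable_real_indicator) auto
  then show ?thesis by simp
qed

text \<open>The real left side of the defining equation forces the product of \<open>u\<close> and
  \<open>laplacian \<phi>\<close> to be integrable and almost everywhere finite. Where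
  \<open>laplacian \<phi>\<close> is nonzero, \<open>u\<close> can then be -\<infinity> only on a
  null set.\<close>

lemma test_function_laplacian:
  assumes "test_function D \<phi>"
  shows "integrable lborel (\<lambda>z. v z * laplacian \<phi> z)"
    and "(\<integral>z. \<phi> z \<partial>\<nu>) = (\<integral>z. v z * laplacian \<phi> z \<partial>lborel)"
    and "AE z in lborel. z \<in> D \<longrightarrow> laplacian \<phi> z \<noteq> 0 \<longrightarrow> u z \<noteq> -\<infinity>"
proof -
  let ?R = "restrict_space lborel D"
  let ?f = "\<lambda>z. u z * ereal (laplacian \<phi> z)"
  have "continuous_on UNIV (laplacian \<phi>)"
    using assms by (intro continuous_on_laplacian) (simp add: test_function_def)
  then have "laplacian \<phi> \<in> borel_measurable ?R"
    by (intro measurable_restrict_space1) (simp add: borel_measurable_continuous_onI)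
  then have m: "?f \<in> borel_measurable ?R"
    by (intro borel_measurable_ereal_times borel_measurable_ereal u_measurable)
  have "ereal_integral ?R ?f = ereal (\<integral>z. \<phi> z \<partial>\<nu>)"
    using laplacian assms by (simp add: is_generalised_laplacian_def)
  note * = ereal_integral_eq_real[OF m this]
  have eq: "(\<lambda>z. v z * laplacian \<phi> z) = (\<lambda>z. indicator D z *\<^sub>R (real_of_ereal (?f z)))"
    by (auto simp: v_def indicator_def)
  have Dl: "D \<inter> space lborel \<in> sets lborel" using open_D by simp
  show "integrable lborel (\<lambda>z. v z * laplacian \<phi> z)"
    using *(3) unfolding eq by (simp only: integrable_restrict_space[OF Dl] set_integrable_def)
  show "(\<integral>z. \<phi> z \<partial>\<nu>) = (\<integral>z. v z * laplacian \<phi> z \<partial>lborel)"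
    using *(4) unfolding eq by (simp only: integral_restrict_space[OF Dl] set_lebesgue_integral_def)
  have "AE z in lborel. z \<in> D \<longrightarrow> \<bar>?f z\<bar> \<noteq> \<infinity>"
    using *(2) by (simp add: AE_restrict_space_iff[OF Dl])
  then show "AE z in lborel. z \<in> D \<longrightarrow> laplacian \<phi> z \<noteq> 0 \<longrightarrow> u z \<noteq> -\<infinity>"
    by eventually_elim (auto split: if_splits)
qed

lemma test_function_smooth_log:
  assumes "0 < \<epsilon>" "\<epsilon> \<le> \<delta>" "cball w \<delta> \<subseteq> D"
  shows "test_function D (\<lambda>z. smooth_log w \<epsilon> z - smooth_log w \<delta> z)"
proof (rule test_functionI[OF _ _ assms(3)])
  show "C_k_on k UNIV (\<lambda>z. smooth_log w \<epsilon> z - smooth_log w \<delta> z)" for k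
    using assms by (intro C_k_on_diff C_k_on_smooth_log) auto
  have "smooth_log w \<epsilon> z - smooth_log w \<delta> z = 0" if "z \<notin> cball w \<delta>" for z
  proof -
    have "\<delta> \<le> cmod (z - w)" using that by (simp add: dist_norm norm_minus_commute)
    then show ?thesis using assms(1,2) by (simp add: smooth_log_eq_ln)
  qed
  then show "{z. smooth_log w \<epsilon> z - smooth_log w \<delta> z \<noteq> 0} \<subseteq> cball w \<delta>"
    by blast
qed

lemma laplacian_smooth_log_diff:
  assumes "0 < \<epsilon>" "0 < \<delta>"
  shows "laplacian (\<lambda>z. smooth_log w \<epsilon> z - smooth_log w \<delta> z) z = 2 * pi * (bump w \<epsilon> z - bump w \<delta> z)"
  using assms by (subst laplacian_diff) (auto simp: C_k_on_smooth_log laplacian_smooth_log algebra_simps)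

text \<open>The difference of the smooth logarithms of radii \<open>\<delta> / 2\<close> and
  \<open>\<delta>\<close> is a test function whose Laplacian is -2 pi times
  \<open>bump w \<delta>\<close> on the annulus between these radii. Placing \<open>z0\<close>
  inside the annulus and dividing by the bump, which has a positive minimum near \<open>z0\<close>,
  yields integrability of \<open>v\<close> there.\<close>

lemma locally_integrable:
  assumes "z0 \<in> D"
  obtains \<eta> where "\<eta> > 0" "set_integrable lborel (cball z0 \<eta>) v"
    "AE z in lborel. z \<in> cball z0 \<eta> \<longrightarrow> u z \<noteq> -\<infinity>"
proof -
  obtain r where r: "r > 0" "cball z0 r \<subseteq> D"
    using open_D assms open_contains_cball by blast
  \<comment> \<open>The centre \<open>w\<close> lies at distance 3/4 \<delta> from
    \<open>z0\<close>. Its disc of radius \<delta> stays within 2 \<delta> = r of \<open>z0\<close>,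
    and the ball of radius \<delta>/8 about \<open>z0\<close> lies at distances between 5/8 \<delta>
    and 7/8 \<delta> from \<open>w\<close>.\<close>
  define \<delta> where "\<delta> = r / 2"
  define w where "w = z0 + of_real (3 / 4 * \<delta>)"
  have \<delta>: "\<delta> > 0" using r by (simp add: \<delta>_def)
  have wz: "cmod (w - z0) = 3 / 4 * \<delta>"
    using \<delta> by (simp add: w_def norm_mult)
  have "cball w \<delta> \<subseteq> cball z0 r"
    using wz r by (auto simp: cball_subset_cball_iff dist_norm \<delta>_def)
  then have wD: "cball w \<delta> \<subseteq> D" using r by blast
  let ?\<phi> = "\<lambda>z. smooth_log w (\<delta> / 2) z - smooth_log w \<delta> z"
  have \<phi>: "test_function D ?\<phi>"
    using \<delta> by (intro test_function_smooth_log wD) auto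
  have annulus: "\<delta> / 2 < cmod (z - w)" "cmod (z - w) < \<delta>" if "z \<in> cball z0 (\<delta> / 8)" for z
  proof -
    have "cmod (z0 - z) \<le> \<delta> / 8" using that by (simp add: dist_norm)
    then show "\<delta> / 2 < cmod (z - w)" "cmod (z - w) < \<delta>"
      using wz \<delta> norm_triangle_ineq4[of "z0 - z" "z0 - w"] norm_triangle_ineq2[of "w - z0" "z - z0"]
        norm_triangle_ineq[of "w - z" "z - z0"]
      by (auto simp: norm_minus_commute algebra_simps)
  qed
  have lap: "laplacian ?\<phi> z = - (2 * pi * bump w \<delta> z)" if "z \<in> cball z0 (\<delta> / 8)" for z
  proof -
    \<comment> \<open>The bump of the smaller radius lives inside the hole of the annulus, so the
      two bumps cannot cancel.\<close>
    have "bump w (\<delta> / 2) z = 0"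
      using bump_support(2)[of "\<delta> / 2" w z] annulus(1)[OF that] \<delta> by fastforce
    then show ?thesis using \<delta> by (subst laplacian_smooth_log_diff) auto
  qed
  have pos: "bump w \<delta> z > 0" if "z \<in> cball z0 (\<delta> / 8)" for z
    using bump_pos[OF \<delta> annulus[OF that]] .
  obtain x where x: "x \<in> cball z0 (\<delta> / 8)" "\<And>z. z \<in> cball z0 (\<delta> / 8) \<Longrightarrow> bump w \<delta> x \<le> bump w \<delta> z"
    using continuous_attains_inf[of "cball z0 (\<delta> / 8)" "bump w \<delta>"] continuous_on_bump[OF \<delta>] \<delta> by auto
  let ?m = "2 * pi * bump w \<delta> x"
  have m: "?m > 0" using pos[OF x(1)] by simp
  have "set_integrable lborel (cball z0 (\<delta> / 8)) v"
    unfolding set_integrable_def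
  proof (rule Bochner_Integration.integrable_bound)
    show "integrable lborel (\<lambda>z. 1 / ?m * (v z * laplacian ?\<phi> z))"
      using test_function_laplacian(1)[OF \<phi>] by (intro integrable_mult_right) auto
    show "AE z in lborel. norm (indicator (cball z0 (\<delta> / 8)) z *\<^sub>R v z) \<le> norm (1 / ?m * (v z * laplacian ?\<phi> z))"
    proof (rule AE_I2)
      fix z
      show "norm (indicator (cball z0 (\<delta> / 8)) z *\<^sub>R v z) \<le> norm (1 / ?m * (v z * laplacian ?\<phi> z))"
      proof (cases "z \<in> cball z0 (\<delta> / 8)")
        case True
        have "1 \<le> bump w \<delta> z / bump w \<delta> x"
          using x(2)[OF True] pos[OF x(1)] by simp
        then have "\<bar>v z\<bar> * 1 \<le> \<bar>v z\<bar> * (bump w \<delta> z / bump w \<delta> x)"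
          by (rule mult_left_mono) simp
        then show ?thesis
          using True pos[OF True] pos[OF x(1)] by (simp only: lap[OF True]) (simp add: abs_mult)
      qed simp
    qed
    show "(\<lambda>z. indicator (cball z0 (\<delta> / 8)) z *\<^sub>R v z) \<in> borel_measurable lborel"
      using v_measurable by (intro borel_measurable_scaleR borel_measurable_indicator) auto
  qed
  moreover have "AE z in lborel. z \<in> cball z0 (\<delta> / 8) \<longrightarrow> u z \<noteq> -\<infinity>"
    using test_function_laplacian(3)[OF \<phi>]
  proof eventually_elim
    case (elim z)
    show ?case
    proof
      assume z: "z \<in> cball z0 (\<delta> / 8)"
      then have "z \<in> cball w \<delta>" using annulus(2)[OF z] by (simp add: dist_norm norm_minus_commute)
      then show "u z \<noteq> -\<infinity>" using elim wD lap[OF z] pos[OF z] by auto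
    qed
  qed
  ultimately show thesis using that[of "\<delta> / 8"] \<delta> by simp
qed

lemma integrable_on_compact:
  assumes "compact C" "C \<subseteq> D"
  shows "integrable lborel (\<lambda>z. v z * indicator C z)"
    and "AE z in lborel. z \<in> C \<longrightarrow> u z \<noteq> -\<infinity>"
proof -
  have "\<forall>z\<in>C. \<exists>\<eta>>0. set_integrable lborel (cball z \<eta>) v \<and> (AE x in lborel. x \<in> cball z \<eta> \<longrightarrow> u x \<noteq> -\<infinity>)"
    using locally_integrable assms(2) by (metis subsetD)
  then obtain \<eta> where \<eta>: "\<And>z. z \<in> C \<Longrightarrow> \<eta> z > 0" "\<And>z. z \<in> C \<Longrightarrow> set_integrable lborel (cball z (\<eta> z)) v"
    "\<And>z. z \<in> C \<Longrightarrow> AE x in lborel. x \<in> cball z (\<eta> z) \<longrightarrow> u x \<noteq> -\<infinity>"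
    by metis
  have "C \<subseteq> (\<Union>z\<in>C. ball z (\<eta> z))" using \<eta>(1) by force
  then obtain I where I: "I \<subseteq> C" "finite I" "C \<subseteq> (\<Union>z\<in>I. ball z (\<eta> z))"
    using compactE_image[OF assms(1), of C "\<lambda>z. ball z (\<eta> z)"] by (metis open_ball)
  have sub: "C \<subseteq> (\<Union>z\<in>I. cball z (\<eta> z))" using I(3) ball_subset_cball by blast
  have "set_integrable lborel (\<Union>z\<in>I. cball z (\<eta> z)) v"
    using I \<eta>(2) by (intro set_integrable_UN) auto
  then have "set_integrable lborel C v"
    by (rule set_integrable_subset) (use assms sub in \<open>auto intro: compact_imp_closed borel_closed\<close>)
  then show "integrable lborel (\<lambda>z. v z * indicator C z)"
    by (simp add: set_integrable_def mult.commute)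
  have "AE x in lborel. \<forall>z\<in>I. x \<in> cball z (\<eta> z) \<longrightarrow> u x \<noteq> -\<infinity>"
    using I \<eta>(3) by (intro AE_finite_allI) auto
  then show "AE z in lborel. z \<in> C \<longrightarrow> u z \<noteq> -\<infinity>"
    by eventually_elim (use sub in blast)
qed

text \<open>The convolution of u with \<open>\<chi>_\<delta>\<close> at \<open>w\<close>. When the
  closed disc lies in \<open>D\<close>, replacing \<open>u\<close> by \<open>v\<close> changes the
  integrand only on a null set.\<close>

definition mean :: "complex \<Rightarrow> real \<Rightarrow> real" where
  "mean w \<delta> = (\<integral>z. v z * bump w \<delta> z \<partial>lborel)"

lemma bump_outside: "\<delta> > 0 \<Longrightarrow> z \<notin> cball w \<delta> \<Longrightarrow> bump w \<delta> z = 0"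
  using bump_support(2)[of \<delta> w z] by (force simp: dist_norm norm_minus_commute)

lemma integrable_v_kernel:
  assumes C: "compact C" "C \<subseteq> D" and \<kappa>: "continuous_on UNIV \<kappa>"
  shows "integrable lborel (\<lambda>z. v z * indicator C z * \<kappa> (w - z))"
proof -
  obtain R where "C \<subseteq> cball 0 R"
    using compact_imp_bounded[OF C(1)] bounded_subset_cball_0 by blast
  then show ?thesis
    by (intro integrable_kernel[OF \<kappa> integrable_on_compact(1)[OF C], of R]) (auto simp: indicator_def)
qed

lemma integrable_v_bump:
  assumes "\<delta> > 0" "cball w \<delta> \<subseteq> D"
  shows "integrable lborel (\<lambda>z. v z * bump w \<delta> z)"
proof -
  have "v z * indicator (cball w \<delta>) z * bump 0 \<delta> (w - z) = v z * bump w \<delta> z" for z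
    using bump_outside[OF assms(1), of z w] by (cases "z \<in> cball w \<delta>") (auto simp: bump_0)
  moreover have "integrable lborel (\<lambda>z. v z * indicator (cball w \<delta>) z * bump 0 \<delta> (w - z))"
    by (rule integrable_v_kernel[OF compact_cball assms(2) continuous_on_bump[OF assms(1)]])
  ultimately show ?thesis by (simp only:)
qed

lemma integrable_bump: "\<delta> > 0 \<Longrightarrow> integrable lborel (bump w \<delta>)"
  and integral_bump: "\<delta> > 0 \<Longrightarrow> (\<integral>z. bump w \<delta> z \<partial>lborel) = 1"
proof -
  assume \<delta>: "\<delta> > 0"
  show i: "integrable lborel (bump w \<delta>)"
    by (rule integrableI_nonneg) (use nn_integral_bump[OF \<delta>] bump_nonneg borel_measurable_bump[OF \<delta>] in auto)
  show "(\<integral>z. bump w \<delta> z \<partial>lborel) = 1"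
    using nn_integral_eq_integral[OF i] nn_integral_bump[OF \<delta>] bump_nonneg
    by (simp add: ennreal_eq_1)
qed

lemma mean_le:
  assumes "\<delta> > 0" "cball w \<delta> \<subseteq> D" "\<And>z. z \<in> cball w \<delta> \<Longrightarrow> u z \<le> ereal c"
  shows "mean w \<delta> \<le> c"
proof -
  have "mean w \<delta> \<le> (\<integral>z. c * bump w \<delta> z \<partial>lborel)"
    unfolding mean_def
  proof (rule integral_mono_AE)
    show "integrable lborel (\<lambda>z. v z * bump w \<delta> z)" by (rule integrable_v_bump[OF assms(1,2)])
    show "integrable lborel (\<lambda>z. c * bump w \<delta> z)" using integrable_bump[OF assms(1)] by simp
    show "AE z in lborel. v z * bump w \<delta> z \<le> c * bump w \<delta> z"
      using integrable_on_compact(2)[OF compact_cball assms(2)]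
    proof eventually_elim
      case (elim z)
      show ?case
      proof (cases "z \<in> cball w \<delta>")
        case True
        then have "v z \<le> c"
          using elim assms(2) assms(3)[OF True] u_not_PInf[of z] by (cases "u z") (auto simp: v_def)
        then show ?thesis using bump_nonneg by (rule mult_right_mono)
      qed (simp add: bump_outside[OF assms(1)])
    qed
  qed
  then show ?thesis using integral_bump[OF assms(1)] by simp
qed

text \<open>The bump is radial, so its mean is a weighted average of circle means, each at least
  \<open>u w\<close>. The argument runs with the nonnegative function M - u, which is allowed to be
  infinite, and returns to real integrals only at the end.\<close>

lemma le_mean:
  assumes \<epsilon>: "\<epsilon> > 0" "cball w \<epsilon> \<subseteq> D" and M: "\<And>z. z \<in> cball w \<epsilon> \<Longrightarrow> u z \<le> ereal M"
    and circle: "\<And>r. 0 \<le> r \<Longrightarrow> r \<le> \<epsilon> \<Longrightarrow> u w \<le> circle_mean u w r"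
  shows "u w \<le> ereal (mean w \<epsilon>)"
proof -
  \<comment> \<open>The cutoff to the disc and the value 0 off \<open>D\<close> give a function that
    is Borel on the whole plane, as the rotation argument requires.\<close>
  define F where "F z = (if z \<in> cball w \<epsilon> then e2ennreal (ereal M - (if z \<in> D then u z else 0)) else 0)" for z
  have [measurable]: "cball w \<epsilon> \<in> sets borel" by simp
  have F [measurable]: "F \<in> borel_measurable borel"
    unfolding F_def[abs_def] using u_measurable' by measurable
  have F_eq: "F z = e2ennreal (ereal M - u z)" if "z \<in> cball w \<epsilon>" for z
    using that \<epsilon>(2) by (auto simp: F_def)
  have [measurable]: "bump 0 \<epsilon> \<in> borel_measurable borel" "bump w \<epsilon> \<in> borel_measurable borel"
    using borel_measurable_bump \<epsilon> by auto
  have [measurable]: "cis \<in> borel_measurable borel"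
    by (intro borel_measurable_continuous_onI continuous_intros)
  have "(\<integral>\<^sup>+z. F (w + z) * ennreal (bump 0 \<epsilon> z) \<partial>lborel) \<le> F w * (\<integral>\<^sup>+z. ennreal (bump 0 \<epsilon> z) \<partial>lborel)"
  proof (rule nn_integral_radial_le)
    show "ennreal (bump 0 \<epsilon> (cis t * z)) = ennreal (bump 0 \<epsilon> z)" for t z
      by (simp add: bump_rotate)
    fix z assume "ennreal (bump 0 \<epsilon> z) \<noteq> 0"
    then have "bump 0 \<epsilon> z \<noteq> 0" by auto
    then have z: "cmod z < \<epsilon>" using bump_support(2)[OF \<epsilon>(1)] by fastforce
    show "(\<integral>\<^sup>+t. F (w + of_real (cmod z) * cis t) * indicator {0..<2 * pi} t \<partial>lborel) \<le> ennreal (2 * pi) * F w"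
      by (rule circle_mean_bound[where u = u and M = M])
         (use z circle M F_eq in \<open>auto simp: subset_iff\<close>)
  qed measurable
  then have 1: "(\<integral>\<^sup>+z. F (w + z) * ennreal (bump 0 \<epsilon> z) \<partial>lborel) \<le> F w"
    by (simp add: nn_integral_bump[OF \<epsilon>(1)])
  have "(\<integral>\<^sup>+z. F z * ennreal (bump w \<epsilon> z) \<partial>lborel) = (\<integral>\<^sup>+z. F z * ennreal (bump w \<epsilon> z) \<partial>distr lborel borel ((+) w))"
    by (simp add: lborel_distr_plus)
  also have "\<dots> = (\<integral>\<^sup>+z. F (w + z) * ennreal (bump 0 \<epsilon> z) \<partial>lborel)"
  proof -
    have "bump w \<epsilon> (w + z) = bump 0 \<epsilon> z" for z
      by (simp add: bump_def sq_dist_def)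
    then show ?thesis
      by (subst nn_integral_distr) auto
  qed
  finally have 2: "(\<integral>\<^sup>+z. F z * ennreal (bump w \<epsilon> z) \<partial>lborel) \<le> F w" using 1 by simp
  have i: "integrable lborel (\<lambda>z. M * bump w \<epsilon> z - v z * bump w \<epsilon> z)"
    using integrable_bump[OF \<epsilon>(1)] integrable_v_bump[OF \<epsilon>] by simp
  have ae: "AE z in lborel. 0 \<le> M * bump w \<epsilon> z - v z * bump w \<epsilon> z \<and>
      ennreal (M * bump w \<epsilon> z - v z * bump w \<epsilon> z) = F z * ennreal (bump w \<epsilon> z)"
    using integrable_on_compact(2)[OF compact_cball \<epsilon>(2)]
  proof eventually_elim
    case (elim z)
    show ?case
    proof (cases "z \<in> cball w \<epsilon>")
      case True
      then obtain x where x: "u z = ereal x" "v z = x" "x \<le> M"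
        using elim \<epsilon>(2) M[OF True] u_not_PInf[of z] by (cases "u z") (auto simp: v_def)
      have "M * bump w \<epsilon> z - v z * bump w \<epsilon> z = (M - x) * bump w \<epsilon> z"
        using x by (simp add: algebra_simps)
      then show ?thesis
        using x F_eq[OF True] bump_nonneg[of w \<epsilon> z] by (simp add: e2ennreal_ereal ennreal_mult)
    qed (simp add: bump_outside[OF \<epsilon>(1)])
  qed
  have "ennreal (M - mean w \<epsilon>) = ennreal (\<integral>z. M * bump w \<epsilon> z - v z * bump w \<epsilon> z \<partial>lborel)"
    using integrable_bump[OF \<epsilon>(1)] integrable_v_bump[OF \<epsilon>] integral_bump[OF \<epsilon>(1)] by (simp add: mean_def)
  also have "\<dots> = (\<integral>\<^sup>+z. ennreal (M * bump w \<epsilon> z - v z * bump w \<epsilon> z) \<partial>lborel)"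
    by (rule nn_integral_eq_integral[symmetric, OF i]) (use ae in auto)
  also have "\<dots> = (\<integral>\<^sup>+z. F z * ennreal (bump w \<epsilon> z) \<partial>lborel)"
    by (rule nn_integral_cong_AE) (use ae in auto)
  finally have 3: "ennreal (M - mean w \<epsilon>) \<le> e2ennreal (ereal M - u w)"
    using 2 F_eq[of w] \<epsilon> by simp
  have "u w \<le> ereal M" using M[of w] \<epsilon>(1) by simp
  then show ?thesis
    using 3 by (cases "u w") (auto simp: e2ennreal_ereal ennreal_le_iff)
qed

lemma u_less_near:
  assumes "w \<in> D" "u w < c"
  obtains \<eta> where "\<eta> > 0" "\<And>z. z \<in> ball w \<eta> \<Longrightarrow> z \<in> D \<and> u z < c"
proof -
  have "w \<in> {z \<in> D. u z < c}" using assms by simp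
  then obtain \<eta> where "\<eta> > 0" "ball w \<eta> \<subseteq> {z \<in> D. u z < c}"
    using open_u_less open_contains_ball by blast
  then show thesis using that by blast
qed

text \<open>Upper semicontinuity keeps \<open>u\<close>, and hence its means over small discs, below
  any number larger than \<open>u w\<close>; the sub-mean inequality keeps the means above
  \<open>u w\<close> for small radii. For \<open>u w = -\<infinity>\<close> the second half is
  vacuous and the first gives divergence to -\<infinity>.\<close>

lemma LIMSEQ_mean:
  assumes w: "w \<in> D" and \<epsilon>: "\<epsilon> \<longlonglongrightarrow> 0" "\<And>n. \<epsilon> n > 0"
  shows "(\<lambda>n. ereal (mean w (\<epsilon> n))) \<longlonglongrightarrow> u w"
proof (rule order_tendstoI)
  fix c assume "u w < c"
  then obtain c' where c': "u w < ereal c'" "ereal c' < c"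
    using ereal_dense2[of "u w" c] by blast
  obtain \<eta> where \<eta>: "\<eta> > 0" "\<And>z. z \<in> ball w \<eta> \<Longrightarrow> z \<in> D \<and> u z < ereal c'"
    using u_less_near[OF w c'(1)] by blast
  have "\<forall>\<^sub>F n in sequentially. \<epsilon> n < \<eta>"
    using \<epsilon>(1) \<eta>(1) by (rule order_tendstoD(2))
  then show "\<forall>\<^sub>F n in sequentially. ereal (mean w (\<epsilon> n)) < c"
  proof eventually_elim
    case (elim n)
    then have "z \<in> D \<and> u z < ereal c'" if "z \<in> cball w (\<epsilon> n)" for z
      using that by (intro \<eta>(2)) simp
    then have "mean w (\<epsilon> n) \<le> c'"
      by (intro mean_le \<epsilon>(2)) (auto intro: less_imp_le)
    then show ?case using c'(2) by (meson ereal_less_eq(3) le_less_trans)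
  qed
next
  fix c assume c: "c < u w"
  obtain M where "u w < ereal M"
    using u_not_PInf[OF w] ereal_dense2[of "u w" \<infinity>] by auto
  then obtain \<eta> where \<eta>: "\<eta> > 0" "\<And>z. z \<in> ball w \<eta> \<Longrightarrow> z \<in> D \<and> u z < ereal M"
    using u_less_near[OF w] by blast
  obtain \<rho> where \<rho>: "\<rho> > 0" "\<And>r. 0 \<le> r \<Longrightarrow> r < \<rho> \<Longrightarrow> u w \<le> circle_mean u w r"
    using subharmonic w unfolding subharmonic_on_def by blast
  have "\<forall>\<^sub>F n in sequentially. \<epsilon> n < min \<eta> \<rho>"
    using \<epsilon>(1) \<eta>(1) \<rho>(1) by (intro order_tendstoD(2)) auto
  then show "\<forall>\<^sub>F n in sequentially. c < ereal (mean w (\<epsilon> n))"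
  proof eventually_elim
    case (elim n)
    then have *: "z \<in> D \<and> u z < ereal M" if "z \<in> cball w (\<epsilon> n)" for z
      using that by (intro \<eta>(2)) simp
    have "u w \<le> ereal (mean w (\<epsilon> n))"
      by (rule le_mean[where M = M]) (use * elim \<rho>(2) \<epsilon>(2) in \<open>auto intro: less_imp_le\<close>)
    then show ?case using c by (rule less_le_trans[rotated])
  qed
qed

lemma integrable_\<nu>_kernel:
  assumes S: "S \<in> sets borel" "S \<subseteq> C" "compact C" "C \<subseteq> D" and \<kappa>: "continuous_on UNIV \<kappa>"
  shows "integrable \<nu> (\<lambda>z. indicator S z / (2 * pi) * \<kappa> (w - z))"
proof -
  obtain R where "C \<subseteq> cball 0 R"
    using compact_imp_bounded[OF S(3)] bounded_subset_cball_0 by blast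
  then show ?thesis
    using S(2) by (intro integrable_kernel[OF \<kappa> integrable_indicator_\<nu>[OF S], of R]) (auto simp: indicator_def)
qed

text \<open>Halving the radius makes the tested functions increase to the excess, while each test
  integral is a difference of two finite means. Only the limit can be infinite, so
  \<open>u w = -\<infinity>\<close> is not a separate case.\<close>

lemma local_riesz:
  assumes \<delta>: "\<delta> > 0" and w: "cball w \<delta> \<subseteq> D"
  shows "u w = ereal (mean w \<delta>) - enn2ereal (\<integral>\<^sup>+z. ennreal (1 / (2 * pi)) * log_excess w \<delta> z \<partial>\<nu>)"
proof -
  define \<epsilon> where "\<epsilon> n = \<delta> / 2 ^ n" for n :: nat
  have \<epsilon>: "\<epsilon> n > 0" "\<epsilon> n \<le> \<delta>" "\<epsilon> (Suc n) \<le> \<epsilon> n" for n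
    using \<delta> by (auto simp: \<epsilon>_def field_simps)
  have "(\<lambda>n. \<delta> * (1 / 2) ^ n) \<longlonglongrightarrow> \<delta> * 0"
    by (intro tendsto_mult tendsto_const LIMSEQ_power_zero) simp
  then have \<epsilon>_lim: "\<epsilon> \<longlonglongrightarrow> 0"
    by (simp add: \<epsilon>_def[abs_def] power_divide)
  define X where "X n = (\<integral>\<^sup>+z. ennreal (1 / (2 * pi)) * ennreal (smooth_log w \<delta> z - smooth_log w (\<epsilon> n) z) \<partial>\<nu>)" for n
  have X: "X n = ennreal (mean w \<delta> - mean w (\<epsilon> n))" and mono: "mean w (\<epsilon> n) \<le> mean w \<delta>" for n
  proof -
    let ?\<phi> = "\<lambda>z. smooth_log w (\<epsilon> n) z - smooth_log w \<delta> z"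
    have \<phi>: "test_function D ?\<phi>" by (rule test_function_smooth_log[OF \<epsilon>(1,2) w])
    have wn: "cball w (\<epsilon> n) \<subseteq> D" using w \<epsilon>(2) by (meson order_trans subset_cball)
    have "(\<integral>z. ?\<phi> z \<partial>\<nu>) = (\<integral>z. v z * (2 * pi * (bump w (\<epsilon> n) z - bump w \<delta> z)) \<partial>lborel)"
      using test_function_laplacian(2)[OF \<phi>] by (simp add: laplacian_smooth_log_diff \<epsilon> \<delta>)
    also have "\<dots> = (\<integral>z. 2 * pi * (v z * bump w (\<epsilon> n) z - v z * bump w \<delta> z) \<partial>lborel)"
      by (intro Bochner_Integration.integral_cong) (auto simp: algebra_simps)
    also have "\<dots> = 2 * pi * (mean w (\<epsilon> n) - mean w \<delta>)"
      using integrable_v_bump[OF \<delta> w] integrable_v_bump[OF \<epsilon>(1) wn] by (simp add: mean_def)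
    finally have I: "(\<integral>z. ?\<phi> z \<partial>\<nu>) = 2 * pi * (mean w (\<epsilon> n) - mean w \<delta>)" .
    let ?\<psi> = "\<lambda>z. 1 / (2 * pi) * (smooth_log w \<delta> z - smooth_log w (\<epsilon> n) z)"
    have c: "continuous_on UNIV (\<lambda>z. smooth_log 0 \<delta> z - smooth_log 0 (\<epsilon> n) z)"
      using \<delta> \<epsilon>(1) by (intro continuous_on_diff continuous_on_smooth_log)
    \<comment> \<open>Both smooth logarithms agree off the disc, so inserting its indicator changes
      nothing, and finiteness of \<open>\<nu>\<close> on the compact disc gives
      integrability.\<close>
    have "integrable \<nu> (\<lambda>z. indicator (cball w \<delta>) z / (2 * pi) * (smooth_log 0 \<delta> (w - z) - smooth_log 0 (\<epsilon> n) (w - z)))"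
      by (rule integrable_\<nu>_kernel[OF _ _ compact_cball w c]) auto
    moreover have "indicator (cball w \<delta>) z / (2 * pi) * (smooth_log 0 \<delta> (w - z) - smooth_log 0 (\<epsilon> n) (w - z)) = ?\<psi> z" for z
    proof (cases "z \<in> cball w \<delta>")
      case False
      then have "\<delta> \<le> cmod (z - w)" by (simp add: dist_norm norm_minus_commute)
      then show ?thesis
        using False \<epsilon>(1,2)[of n] \<delta> by (simp add: smooth_log_eq_ln)
    qed (simp add: smooth_log_0)
    ultimately have i: "integrable \<nu> ?\<psi>" by simp
    have "(\<integral>z. ?\<psi> z \<partial>\<nu>) = (\<integral>z. - (1 / (2 * pi)) * ?\<phi> z \<partial>\<nu>)"
      by (intro Bochner_Integration.integral_cong) (auto simp: algebra_simps)
    also have "\<dots> = mean w \<delta> - mean w (\<epsilon> n)"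
      unfolding integral_mult_right_zero I by (simp add: field_simps)
    finally have J: "(\<integral>z. ?\<psi> z \<partial>\<nu>) = mean w \<delta> - mean w (\<epsilon> n)" .
    have nonneg: "?\<psi> z \<ge> 0" for z
      using smooth_log_mono[OF \<epsilon>(1,2)] by simp
    have "X n = (\<integral>\<^sup>+z. ennreal (?\<psi> z) \<partial>\<nu>)"
      unfolding X_def by (intro nn_integral_cong, subst ennreal_mult') auto
    also have "\<dots> = ennreal (\<integral>z. ?\<psi> z \<partial>\<nu>)"
      using nonneg by (intro nn_integral_eq_integral[OF i]) auto
    finally show "X n = ennreal (mean w \<delta> - mean w (\<epsilon> n))"
      unfolding J .
    have "0 \<le> (\<integral>z. ?\<psi> z \<partial>\<nu>)"
      using nonneg by (intro Bochner_Integration.integral_nonneg)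
    then show "mean w (\<epsilon> n) \<le> mean w \<delta>"
      unfolding J by simp
  qed
  have "X \<longlonglongrightarrow> (\<integral>\<^sup>+z. ennreal (1 / (2 * pi)) * log_excess w \<delta> z \<partial>\<nu>)"
    unfolding X_def[abs_def]
  proof (rule nn_integral_LIMSEQ)
    show "incseq (\<lambda>n z. ennreal (1 / (2 * pi)) * ennreal (smooth_log w \<delta> z - smooth_log w (\<epsilon> n) z))"
      using smooth_log_mono[OF \<epsilon>(1,3)]
      by (intro incseq_SucI le_funI mult_left_mono ennreal_leI) auto
    show "(\<lambda>z. ennreal (1 / (2 * pi)) * ennreal (smooth_log w \<delta> z - smooth_log w (\<epsilon> n) z)) \<in> borel_measurable \<nu>" for n
      by (rule borel_measurable_\<nu>)
         (use borel_measurable_smooth_log[OF \<delta>] borel_measurable_smooth_log[OF \<epsilon>(1)] in measurable)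
    show "(\<lambda>n. ennreal (1 / (2 * pi)) * ennreal (smooth_log w \<delta> z - smooth_log w (\<epsilon> n) z))
        \<longlonglongrightarrow> ennreal (1 / (2 * pi)) * log_excess w \<delta> z" for z
      using LIMSEQ_log_excess[OF \<delta>] unfolding \<epsilon>_def by (intro ennreal_tendsto_cmult) auto
  qed
  \<comment> \<open>The first term is a real constant, so subtraction is continuous even if the
    integrals tend to \<infinity>.\<close>
  then have "(\<lambda>n. ereal (mean w \<delta>) - enn2ereal (X n))
      \<longlonglongrightarrow> ereal (mean w \<delta>) - enn2ereal (\<integral>\<^sup>+z. ennreal (1 / (2 * pi)) * log_excess w \<delta> z \<partial>\<nu>)"
    by (intro tendsto_diff_ereal_general tendsto_const tendsto_enn2erealI) auto
  moreover have "ereal (mean w \<delta>) - enn2ereal (X n) = ereal (mean w (\<epsilon> n))" for n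
    using mono[of n] by (simp add: X enn2ereal_ennreal)
  moreover have "(\<lambda>n. ereal (mean w (\<epsilon> n))) \<longlonglongrightarrow> u w"
    using w \<delta> by (intro LIMSEQ_mean \<epsilon>_lim \<epsilon>(1)) auto
  ultimately show ?thesis
    using LIMSEQ_unique by simp blast
qed


section \<open>Splitting off the potential on a relatively compact set\<close>

lemma integral_bump_\<nu>:
  assumes "\<delta> > 0" "cball w \<delta> \<subseteq> D"
  shows "(\<integral>z. v z * laplacian (bump w \<delta>) z \<partial>lborel) = (\<integral>z. bump w \<delta> z \<partial>\<nu>)"
proof -
  have "test_function D (bump w \<delta>)"
    using bump_outside[OF assms(1)] by (intro test_functionI[OF C_k_on_bump _ assms(2)] assms(1)) blast
  then show ?thesis
    by (rule test_function_laplacian(2)[symmetric])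
qed

theorem riesz_decomposition:
  assumes K: "open K" "compact (closure K)" "closure K \<subseteq> D"
  shows "\<exists>\<mu> h. sets \<mu> = sets borel \<and> finite_measure \<mu> \<and>
           scale_measure (ennreal (2 * pi)) \<mu> = restrict_measure \<nu> K \<and>
           harmonic_on K h \<and>
           (\<forall>z\<in>K. u z = log_potential \<mu> z + ereal (h z))"
proof -
  have KD: "K \<subseteq> D" using K(3) closure_subset by blast
  have [measurable]: "K \<in> sets borel" using K(1) by simp
  obtain \<delta> where \<delta>: "\<delta> > 0" "(\<Union>x\<in>closure K. cball x \<delta>) \<subseteq> D"
    using compact_subset_open_imp_cball_epsilon_subset[OF K(2) open_D K(3)] by blast
  \<comment> \<open>The compact \<delta>-neighbourhood of the closure of \<open>K\<close> contains
    every disc that occurs. Cutting \<open>v\<close> down to \<open>C\<close> makes it integrable on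
    the plane without changing any mean at a point of \<open>K\<close>.\<close>
  define C where "C = {x + y |x y. x \<in> closure K \<and> y \<in> cball 0 \<delta>}"
  have C: "compact C" unfolding C_def by (rule compact_sums[OF K(2) compact_cball])
  have "C \<subseteq> (\<Union>x\<in>closure K. cball x \<delta>)"
    by (force simp: C_def dist_norm)
  then have CD: "C \<subseteq> D" using \<delta>(2) by blast
  have ballC: "cball w \<delta> \<subseteq> C" if "w \<in> K" for w
  proof
    fix z assume "z \<in> cball w \<delta>"
    then have "z = w + (z - w)" "z - w \<in> cball 0 \<delta>"
      by (auto simp: dist_norm norm_minus_commute)
    moreover have "w \<in> closure K" using that closure_subset by blast
    ultimately show "z \<in> C" unfolding C_def by blast
  qed
  have ballD: "cball w \<delta> \<subseteq> D" if "w \<in> K" for w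
    using ballC[OF that] CD by blast
  have KC: "K \<subseteq> C"
  proof
    fix w assume "w \<in> K"
    moreover have "w \<in> cball w \<delta>" using \<delta>(1) by simp
    ultimately show "w \<in> C" using ballC by blast
  qed
  have C_borel [measurable]: "C \<in> sets borel" using C by (simp add: compact_imp_closed)
  obtain R where R: "C \<subseteq> cball 0 R"
    using compact_imp_bounded[OF C] bounded_subset_cball_0 by blast

  \<comment> \<open>These are the densities of \<sigma> = \<Delta>u / (2 pi) on \<open>K\<close> and
    on \<open>C - K\<close>. For \<open>w\<close> in \<open>K\<close> the excess vanishes off
    \<open>C\<close>, so the two pieces carry the whole integral.\<close>
  define iK where "iK z = (indicator K z / (2 * pi) :: real)" for z
  define iC where "iC z = (indicator (C - K) z / (2 * pi) :: real)" for z
  have iK: "integrable \<nu> iK"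
    unfolding iK_def[abs_def] by (rule integrable_indicator_\<nu>[OF _ KC C CD]) measurable
  have iC: "integrable \<nu> iC"
    unfolding iC_def[abs_def] by (rule integrable_indicator_\<nu>[OF _ _ C CD]) auto
  have iKR: "{z. iK z \<noteq> 0} \<subseteq> cball 0 R"
    using R KC by (auto simp: iK_def indicator_def split: if_splits)
  have iCR: "{z. iC z \<noteq> 0} \<subseteq> cball 0 R"
    using R by (auto simp: iC_def indicator_def split: if_splits)
  have vC: "integrable lborel (\<lambda>z. v z * indicator C z)"
    by (rule integrable_on_compact(1)[OF C CD])
  have vCR: "{z. v z * indicator C z \<noteq> 0} \<subseteq> cball 0 R"
    using R by (auto simp: indicator_def)
  have nonneg: "iK z \<ge> 0" "iC z \<ge> 0" for z
    by (auto simp: iK_def iC_def)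
  have idl: "(\<lambda>z::complex. z) \<in> borel_measurable lborel" by simp

  \<comment> \<open>The form as a density followed by an image under the identity reduces integrals
    against \<open>\<mu>\<close> to integrals against \<open>\<nu>\<close>; the agreement with the
    restricted Laplacian is checked separately.\<close>
  define \<mu> where "\<mu> = distr (density \<nu> (\<lambda>z. ennreal (iK z))) borel (\<lambda>z. z)"
  have iKm [measurable]: "iK \<in> borel_measurable borel" "iK \<in> borel_measurable \<nu>"
    using iK by (auto simp: iK_def[abs_def])
  have iCm [measurable]: "iC \<in> borel_measurable borel" "iC \<in> borel_measurable \<nu>"
    using iC by (auto simp: iC_def[abs_def])
  have idm: "(\<lambda>z. z) \<in> measurable (density \<nu> (\<lambda>z. ennreal (iK z))) borel"
    by simp
  have nn\<mu>: "(\<integral>\<^sup>+z. f z \<partial>\<mu>) = (\<integral>\<^sup>+z. ennreal (iK z) * f z \<partial>\<nu>)" if "f \<in> borel_measurable borel" for f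
    unfolding \<mu>_def using borel_measurable_\<nu>[OF that] that
    by (subst nn_integral_distr[OF idm]) (auto simp: nn_integral_density)
  have sets\<mu>: "sets \<mu> = sets borel" by (simp add: \<mu>_def)
  have em\<mu>: "emeasure \<mu> A = (\<integral>\<^sup>+z. ennreal (iK z) * indicator A z \<partial>\<nu>)" if "A \<in> sets borel" for A
  proof -
    have "emeasure \<mu> A = (\<integral>\<^sup>+z. indicator A z \<partial>\<mu>)" using that sets\<mu> by simp
    also have "\<dots> = (\<integral>\<^sup>+z. ennreal (iK z) * indicator A z \<partial>\<nu>)" using that by (intro nn\<mu>) simp
    finally show ?thesis .
  qed
  have "emeasure \<mu> (space \<mu>) < \<infinity>"
  proof -
    have "emeasure \<mu> (space \<mu>) = (\<integral>\<^sup>+z. ennreal (iK z) \<partial>\<nu>)"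
      using em\<mu>[of UNIV] by (simp add: \<mu>_def)
    also have "\<dots> < \<infinity>"
      using nn_integral_eq_integral[OF iK] nonneg by simp
    finally show ?thesis .
  qed
  then have fin\<mu>: "finite_measure \<mu>" by (intro finite_measureI) auto
  have scale: "scale_measure (ennreal (2 * pi)) \<mu> = restrict_measure \<nu> K"
  proof (rule measure_eqI)
    show "sets (scale_measure (ennreal (2 * pi)) \<mu>) = sets (restrict_measure \<nu> K)"
      by (simp add: sets\<mu> restrict_measure_def)
    fix A assume "A \<in> sets (scale_measure (ennreal (2 * pi)) \<mu>)"
    then have A: "A \<in> sets borel" using sets\<mu> by simp
    have AK: "A \<inter> K \<in> sets \<nu>" "K \<inter> space \<nu> \<in> sets \<nu>"
      using A KD by (auto intro!: in_sets_\<nu> simp: space_\<nu>)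
    have Am: "(indicator A :: complex \<Rightarrow> ennreal) \<in> borel_measurable \<nu>"
      using A by (intro borel_measurable_\<nu>) simp
    have "emeasure (scale_measure (ennreal (2 * pi)) \<mu>) A = ennreal (2 * pi) * (\<integral>\<^sup>+z. ennreal (iK z) * indicator A z \<partial>\<nu>)"
      by (simp add: em\<mu>[OF A])
    also have "\<dots> = (\<integral>\<^sup>+z. ennreal (2 * pi) * (ennreal (iK z) * indicator A z) \<partial>\<nu>)"
      using Am by (subst nn_integral_cmult) auto
    also have "\<dots> = (\<integral>\<^sup>+z. indicator (A \<inter> K) z \<partial>\<nu>)"
      by (intro nn_integral_cong)
         (auto simp: iK_def indicator_def ennreal_mult'[symmetric])
    also have "\<dots> = emeasure \<nu> (A \<inter> K)"
      using AK by simp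
    also have "\<dots> = emeasure (restrict_measure \<nu> K) A"
    proof -
      have "(\<lambda>z. z) -` A \<inter> space (restrict_space \<nu> K) = A \<inter> K"
        using KD by (auto simp: space_restrict_space space_\<nu>)
      then have "emeasure (restrict_measure \<nu> K) A = emeasure (restrict_space \<nu> K) (A \<inter> K)"
        unfolding restrict_measure_def using A
        by (subst emeasure_distr) (auto intro: measurable_restrict_space1)
      then show ?thesis
        using AK by (subst (asm) emeasure_restrict_space) auto
    qed
    finally show "emeasure (scale_measure (ennreal (2 * pi)) \<mu>) A = emeasure (restrict_measure \<nu> K) A" .
  qed

  \<comment> \<open>The local formula is the mean minus the excess over \<open>C - K\<close> minus
    the excess over \<open>K\<close>. The last is the integral of the smooth logarithm over
    \<open>K\<close> minus the potential, so everything except the potential is collected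
    here.\<close>
  define h where "h w = (\<integral>z. v z * indicator C z * bump 0 \<delta> (w - z) \<partial>lborel)
      - (\<integral>z. iC z * (smooth_log 0 \<delta> (w - z) - ln (cmod (w - z))) \<partial>\<nu>)
      - (\<integral>z. iK z * smooth_log 0 \<delta> (w - z) \<partial>\<nu>)" for w
  text \<open>Near a point of \<open>K\<close> the logarithm in \<open>h\<close> may be replaced by a smooth kernel, as the
    integral extends over the complement of \<open>K\<close> only.\<close>
  have ln_eq: "iC z * (smooth_log 0 \<delta> (w - z) - ln (cmod (w - z)))
      = iC z * (smooth_log 0 \<delta> (w - z) - smooth_log 0 \<eta> (w - z))"
    if "\<eta> > 0" "cball w \<eta> \<subseteq> K" for w z \<eta>
  proof (cases "z \<in> K")
    case False
    then have "z \<notin> cball w \<eta>" using that(2) by blast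
    then have "\<eta> \<le> cmod (w - z - 0)" by (simp add: dist_norm)
    then show ?thesis using smooth_log_eq_ln[OF that(1), of "w - z" 0] by simp
  qed (simp add: iC_def)
  have smooth: "continuous_on UNIV (\<lambda>z. smooth_log 0 \<delta> z - smooth_log 0 \<eta> z)"
    "C_k_on k UNIV (\<lambda>z. smooth_log 0 \<delta> z - smooth_log 0 \<eta> z)" if "\<eta> > 0" for \<eta> k
    using that \<delta>(1) by (auto intro!: C_k_on_diff C_k_on_smooth_log continuous_on_diff continuous_on_smooth_log)

  have decomp: "u w = log_potential \<mu> w + ereal (h w)" if w: "w \<in> K" for w
  proof -
    obtain \<eta> where \<eta>: "\<eta> > 0" "cball w \<eta> \<subseteq> K"
      using K(1) w open_contains_cball by blast
    have le: "log_excess w \<delta> \<in> borel_measurable borel" "log_excess w \<delta> \<in> borel_measurable \<nu>"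
      using borel_measurable_log_excess[OF \<delta>(1)] by (auto intro: borel_measurable_\<nu>)
    note [measurable] = le
    have sl [measurable]: "smooth_log w \<delta> \<in> borel_measurable borel"
      by (rule borel_measurable_smooth_log[OF \<delta>(1)])
    have mean_eq: "(\<integral>z. v z * indicator C z * bump 0 \<delta> (w - z) \<partial>lborel) = mean w \<delta>"
      unfolding mean_def
    proof (intro Bochner_Integration.integral_cong refl)
      fix z
      have "bump w \<delta> z = 0" if "z \<notin> C"
        using that ballC[OF w] bump_outside[OF \<delta>(1)] by blast
      then show "v z * indicator C z * bump 0 \<delta> (w - z) = v z * bump w \<delta> z"
        by (cases "z \<in> C") (auto simp: bump_0)
    qed
    have iS: "integrable \<nu> (\<lambda>z. iK z * smooth_log w \<delta> z)"
      using integrable_kernel[OF continuous_on_smooth_log[OF \<delta>(1)] iK iKR id_measurable_\<nu>, of 0 w]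
      by (simp add: smooth_log_0)
    define S where "S = (\<integral>z. iK z * smooth_log w \<delta> z \<partial>\<nu>)"
    \<comment> \<open>\<open>P\<close> may be infinite. It appears as
      \<open>mean w \<delta> - T - P\<close> in \<open>u w\<close> and as \<open>S - P\<close> in
      the potential, so it is never cancelled; the remaining quantities are real.\<close>
    define P where "P = (\<integral>\<^sup>+z. ennreal (iK z) * log_excess w \<delta> z \<partial>\<nu>)"
    define T where "T = (\<integral>z. iC z * (smooth_log 0 \<delta> (w - z) - ln (cmod (w - z))) \<partial>\<nu>)"
    have h: "h w = mean w \<delta> - T - S"
      by (simp add: h_def mean_eq T_def S_def smooth_log_0)
    have "(\<integral>\<^sup>+z. ennreal (1 / (2 * pi)) * log_excess w \<delta> z \<partial>\<nu>)
        = (\<integral>\<^sup>+z. ennreal (iK z) * log_excess w \<delta> z + ennreal (iC z) * log_excess w \<delta> z \<partial>\<nu>)"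
    proof (intro nn_integral_cong)
      fix z
      show "ennreal (1 / (2 * pi)) * log_excess w \<delta> z
          = ennreal (iK z) * log_excess w \<delta> z + ennreal (iC z) * log_excess w \<delta> z"
      proof (cases "z \<in> C")
        case True
        then show ?thesis by (cases "z \<in> K") (auto simp: iK_def iC_def)
      next
        case False
        then have "z \<notin> cball w \<delta>" using ballC[OF w] by blast
        then have "\<delta> \<le> cmod (z - w)" by (simp add: dist_norm norm_minus_commute)
        then show ?thesis using log_excess_eq_0[OF \<delta>(1)] by simp
      qed
    qed
    also have "\<dots> = P + (\<integral>\<^sup>+z. ennreal (iC z) * log_excess w \<delta> z \<partial>\<nu>)"
      unfolding P_def by (intro nn_integral_add) measurable
    also have "(\<integral>\<^sup>+z. ennreal (iC z) * log_excess w \<delta> z \<partial>\<nu>)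
        = (\<integral>\<^sup>+z. ennreal (iC z * (smooth_log 0 \<delta> (w - z) - ln (cmod (w - z)))) \<partial>\<nu>)"
    proof (intro nn_integral_cong)
      fix z
      show "ennreal (iC z) * log_excess w \<delta> z = ennreal (iC z * (smooth_log 0 \<delta> (w - z) - ln (cmod (w - z))))"
      proof (cases "z = w")
        \<comment> \<open>The excess is infinite here, but its weight is 0 because \<open>w\<close>
          lies in \<open>K\<close>, and 0 times \<infinity> is 0 in \<open>ennreal\<close>.\<close>
        case True
        then show ?thesis using w by (simp add: iC_def)
      next
        case False
        then show ?thesis
          using nonneg(2)[of z]
          by (simp add: log_excess_def ennreal_mult' smooth_log_0 norm_minus_commute)
      qed
    qed
    also have "\<dots> = ennreal T"
      unfolding T_def
    proof (rule nn_integral_eq_integral)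
      show "integrable \<nu> (\<lambda>z. iC z * (smooth_log 0 \<delta> (w - z) - ln (cmod (w - z))))"
        unfolding ln_eq[OF \<eta>] by (rule integrable_kernel[OF smooth(1)[OF \<eta>(1)] iC iCR id_measurable_\<nu>])
      show "AE z in \<nu>. 0 \<le> iC z * (smooth_log 0 \<delta> (w - z) - ln (cmod (w - z)))"
      proof (rule AE_I2)
        fix z
        show "0 \<le> iC z * (smooth_log 0 \<delta> (w - z) - ln (cmod (w - z)))"
          using ln_le_smooth_log[OF \<delta>(1), of "w - z" 0] w nonneg(2)[of z]
          by (cases "z = w") (auto simp: iC_def)
      qed
    qed
    finally have u: "u w = ereal (mean w \<delta>) - enn2ereal (P + ennreal T)"
      using local_riesz[OF \<delta>(1) ballD[OF w]] by simp
    have T: "T \<ge> 0"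
      unfolding T_def
    proof (rule Bochner_Integration.integral_nonneg)
      fix z
      show "0 \<le> iC z * (smooth_log 0 \<delta> (w - z) - ln (cmod (w - z)))"
        using ln_le_smooth_log[OF \<delta>(1), of "w - z" 0] w nonneg(2)[of z]
        by (cases "z = w") (auto simp: iC_def)
    qed
    \<comment> \<open>Writing the logarithm as smooth part minus excess makes the potential a real
      number minus the same excess integral that occurs in \<open>u w\<close>.\<close>
    have "log_potential \<mu> w = ereal (\<integral>z. smooth_log w \<delta> z \<partial>\<mu>) - enn2ereal (\<integral>\<^sup>+z. log_excess w \<delta> z \<partial>\<mu>)"
      unfolding log_potential_def
    proof (rule ereal_integral_diff)
      show "integrable \<mu> (smooth_log w \<delta>)"
        unfolding \<mu>_def using iS nonneg sl borel_measurable_\<nu>[OF sl]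
        by (subst integrable_distr_eq[OF idm]) (auto simp: integrable_density)
      show "log_excess w \<delta> \<in> borel_measurable \<mu>"
        using le(1) sets\<mu> measurable_cong_sets by blast
      fix z
      show "(if w = z then - \<infinity> else ereal (ln (cmod (w - z))))
          = ereal (smooth_log w \<delta> z) - enn2ereal (log_excess w \<delta> z)"
        using ln_le_smooth_log[OF \<delta>(1), of z w]
        by (auto simp: log_excess_def enn2ereal_ennreal norm_minus_commute)
    qed
    also have "(\<integral>z. smooth_log w \<delta> z \<partial>\<mu>) = S"
      unfolding \<mu>_def S_def using nonneg sl borel_measurable_\<nu>[OF sl]
      by (subst integral_distr[OF idm]) (auto simp: integral_density)
    also have "(\<integral>\<^sup>+z. log_excess w \<delta> z \<partial>\<mu>) = P"
      unfolding P_def by (rule nn\<mu>[OF le(1)])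
    finally show ?thesis
      using u T unfolding h
      by (cases P) (auto simp: enn2ereal_ennreal ennreal_plus[symmetric] simp del: ennreal_plus)
  qed

  have harmonic: "harmonic_on K h"
  proof -
    have "\<exists>U. open U \<and> w0 \<in> U \<and> C_k_on 2 U h \<and> laplacian h w0 = 0" if w0: "w0 \<in> K" for w0
    proof -
      obtain r where r: "r > 0" "cball w0 r \<subseteq> K"
        using K(1) w0 open_contains_cball by blast
      \<comment> \<open>Half of \<open>r\<close> is taken so that the disc of radius
        \<open>\<eta>\<close> about every \<open>w\<close> in \<open>ball w0 \<eta>\<close> stays in
        \<open>K\<close>: one smooth kernel then represents \<open>h\<close> on a whole
        neighbourhood of \<open>w0\<close>.\<close>
      define \<eta> where "\<eta> = r / 2"
      have \<eta>: "\<eta> > 0" using r by (simp add: \<eta>_def)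
      have \<eta>K: "cball w \<eta> \<subseteq> K" if "w \<in> ball w0 \<eta>" for w
      proof -
        have "cball w \<eta> \<subseteq> cball w0 r"
          using that by (auto simp: cball_subset_cball_iff \<eta>_def dist_commute)
        then show ?thesis using r(2) by blast
      qed
      define h1 where "h1 w = (\<integral>z. v z * indicator C z * bump 0 \<delta> (w - z) \<partial>lborel)" for w
      define h2 where "h2 w = (\<integral>z. iC z * (smooth_log 0 \<delta> (w - z) - smooth_log 0 \<eta> (w - z)) \<partial>\<nu>)" for w
      define h3 where "h3 w = (\<integral>z. iK z * smooth_log 0 \<delta> (w - z) \<partial>\<nu>)" for w
      have heq: "h w = h1 w - h2 w - h3 w" if "w \<in> ball w0 \<eta>" for w
        unfolding h_def h1_def h2_def h3_def ln_eq[OF \<eta> \<eta>K[OF that]] ..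
      have c: "C_k_on k UNIV h1" "C_k_on k UNIV h2" "C_k_on k UNIV h3" for k
        unfolding h1_def[abs_def] h2_def[abs_def] h3_def[abs_def]
        using C_k_on_kernel_integral[OF C_k_on_bump[OF \<delta>(1)] vC vCR idl]
          C_k_on_kernel_integral[OF smooth(2)[OF \<eta>] iC iCR id_measurable_\<nu>]
          C_k_on_kernel_integral[OF C_k_on_smooth_log[OF \<delta>(1)] iK iKR id_measurable_\<nu>] by blast+
      have "C_k_on 2 UNIV (\<lambda>w. h1 w - h2 w - h3 w)"
        by (intro C_k_on_diff c open_UNIV)
      then have "C_k_on 2 (ball w0 \<eta>) (\<lambda>w. h1 w - h2 w - h3 w)"
        by (rule C_k_on_subset) simp
      then have ck: "C_k_on 2 (ball w0 \<eta>) h"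
        using C_k_on_cong[of "ball w0 \<eta>" h "\<lambda>w. h1 w - h2 w - h3 w" 2] heq by simp
      have in_ball: "w0 \<in> ball w0 \<eta>" using \<eta> by simp
      have "laplacian h w0 = laplacian (\<lambda>w. h1 w - h2 w - h3 w) w0"
        using laplacian_cong[of "ball w0 \<eta>" w0 h "\<lambda>w. h1 w - h2 w - h3 w"] in_ball heq by blast
      also have "\<dots> = laplacian h1 w0 - laplacian h2 w0 - laplacian h3 w0"
        by (simp add: laplacian_diff C_k_on_diff c)
      also have "laplacian h1 w0 = (\<integral>z. bump w0 \<delta> z \<partial>\<nu>)"
      proof -
        have "laplacian h1 w0 = (\<integral>z. v z * indicator C z * laplacian (bump 0 \<delta>) (w0 - z) \<partial>lborel)"
          unfolding h1_def[abs_def] by (rule laplacian_kernel_integral[OF C_k_on_bump[OF \<delta>(1)] vC vCR idl])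
        also have "\<dots> = (\<integral>z. v z * laplacian (bump w0 \<delta>) z \<partial>lborel)"
        proof (intro Bochner_Integration.integral_cong refl)
          fix z
          \<comment> \<open>The kernel was differentiated in the variable w, the test function must
            be differentiated in z; the sign of the reflection cancels at second order.\<close>
          have "laplacian (bump w0 \<delta>) z = laplacian (\<lambda>z. bump 0 \<delta> (w0 - z)) z"
            by (simp add: bump_0)
          also have "\<dots> = laplacian (bump 0 \<delta>) (w0 - z)"
            by (rule laplacian_reflect[OF C_k_on_bump[OF \<delta>(1)]])
          finally have 1: "laplacian (bump 0 \<delta>) (w0 - z) = laplacian (bump w0 \<delta>) z" ..
          have "laplacian (bump w0 \<delta>) z = 0" if "z \<notin> C"
          proof -
            have z: "z \<in> - cball w0 \<delta>" using that ballC[OF w0] by blast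
            have "laplacian (bump w0 \<delta>) z = laplacian (\<lambda>_. 0) z"
              by (rule laplacian_cong[OF _ z]) (auto simp: bump_outside[OF \<delta>(1)])
            also have "\<dots> = 0"
              using laplacian_diff[OF C_k_on_const C_k_on_const, of 0 0 z] by simp
            finally show ?thesis .
          qed
          then show "v z * indicator C z * laplacian (bump 0 \<delta>) (w0 - z) = v z * laplacian (bump w0 \<delta>) z"
            unfolding 1 by (cases "z \<in> C") auto
        qed
        also have "\<dots> = (\<integral>z. bump w0 \<delta> z \<partial>\<nu>)"
          by (rule integral_bump_\<nu>[OF \<delta>(1) ballD[OF w0]])
        finally show ?thesis .
      qed
      also have "laplacian h2 w0 = (\<integral>z. iC z * (2 * pi * bump w0 \<delta> z) \<partial>\<nu>)"
      proof -
        have "laplacian h2 w0 = (\<integral>z. iC z * laplacian (\<lambda>z. smooth_log 0 \<delta> z - smooth_log 0 \<eta> z) (w0 - z) \<partial>\<nu>)"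
          unfolding h2_def[abs_def] by (rule laplacian_kernel_integral[OF smooth(2)[OF \<eta>] iC iCR id_measurable_\<nu>])
        also have "\<dots> = (\<integral>z. iC z * (2 * pi * bump w0 \<delta> z) \<partial>\<nu>)"
        proof (intro Bochner_Integration.integral_cong refl)
          fix z
          show "iC z * laplacian (\<lambda>z. smooth_log 0 \<delta> z - smooth_log 0 \<eta> z) (w0 - z) = iC z * (2 * pi * bump w0 \<delta> z)"
          proof (cases "z \<in> K")
            \<comment> \<open>Off \<open>K\<close> the point lies outside the disc of radius
              \<open>\<eta>\<close>, where the auxiliary smooth logarithm has Laplacian 0.\<close>
            case False
            then have "z \<notin> cball w0 \<eta>" using \<eta>K[OF in_ball] by blast
            then show ?thesis
              by (simp add: laplacian_smooth_log_diff[OF \<delta>(1) \<eta>] bump_0 bump_outside[OF \<eta>])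
          qed (simp add: iC_def)
        qed
        finally show ?thesis .
      qed
      also have "laplacian h3 w0 = (\<integral>z. iK z * (2 * pi * bump w0 \<delta> z) \<partial>\<nu>)"
      proof -
        have "laplacian h3 w0 = (\<integral>z. iK z * laplacian (smooth_log 0 \<delta>) (w0 - z) \<partial>\<nu>)"
          unfolding h3_def[abs_def]
          by (rule laplacian_kernel_integral[OF C_k_on_smooth_log[OF \<delta>(1)] iK iKR id_measurable_\<nu>])
        then show ?thesis by (simp add: laplacian_smooth_log[OF \<delta>(1)] bump_0)
      qed
      \<comment> \<open>On \<open>C\<close>, which contains the support of the bump,
        \<open>iC\<close> and \<open>iK\<close> add up to 1 / (2 pi), so the three Laplacians
        cancel.\<close>
      also have "(\<integral>z. bump w0 \<delta> z \<partial>\<nu>)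
          = (\<integral>z. iC z * (2 * pi * bump w0 \<delta> z) + iK z * (2 * pi * bump w0 \<delta> z) \<partial>\<nu>)"
      proof (intro Bochner_Integration.integral_cong refl)
        fix z
        have "bump w0 \<delta> z = 0" if "z \<notin> C"
          using that ballC[OF w0] bump_outside[OF \<delta>(1)] by blast
        then show "bump w0 \<delta> z = iC z * (2 * pi * bump w0 \<delta> z) + iK z * (2 * pi * bump w0 \<delta> z)"
          using KC by (cases "z \<in> K"; cases "z \<in> C") (auto simp: iC_def iK_def)
      qed
      also have "\<dots> = (\<integral>z. iC z * (2 * pi * bump w0 \<delta> z) \<partial>\<nu>) + (\<integral>z. iK z * (2 * pi * bump w0 \<delta> z) \<partial>\<nu>)"
      proof (rule Bochner_Integration.integral_add)
        have "continuous_on UNIV (\<lambda>z. 2 * pi * bump 0 \<delta> z)"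
          by (intro continuous_intros continuous_on_bump \<delta>(1))
        from integrable_kernel[OF this iC iCR id_measurable_\<nu>, of w0]
          integrable_kernel[OF this iK iKR id_measurable_\<nu>, of w0]
        show "integrable \<nu> (\<lambda>z. iC z * (2 * pi * bump w0 \<delta> z))" "integrable \<nu> (\<lambda>z. iK z * (2 * pi * bump w0 \<delta> z))"
          by (simp_all add: bump_0)
      qed
      finally have "laplacian h w0 = 0" by simp
      then show ?thesis using ck in_ball by blast
    qed
    then show ?thesis
      unfolding harmonic_on_def using K(1) C_k_on_locally[of K 2 h] by blast
  qed
  show ?thesis
    using sets\<mu> fin\<mu> scale harmonic decomp by blast
qed

end

theorem theorem2p44:
  fixes D K :: "complex set" and u :: "complex \<Rightarrow> ereal" and \<Delta>u :: "complex measure"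
  assumes "domain_in_C D"
    and "subharmonic_on D u"
    and "\<exists>z\<in>D. u z \<noteq> -\<infinity>"
    and "is_generalised_laplacian D u \<Delta>u"
    and "open K" and "K \<subseteq> D"
    and "compact (closure K)" and "closure K \<subseteq> D"
  shows "\<exists>\<mu> h. sets \<mu> = sets borel \<and> finite_measure \<mu> \<and>
           scale_measure (ennreal (2 * pi)) \<mu> = restrict_measure \<Delta>u K \<and>
           harmonic_on K h \<and>
           (\<forall>z\<in>K. u z = log_potential \<mu> z + ereal (h z))"
proof -
  obtain G g g' b where "log_profile G g g' b"
    using log_profile_exists by blast
  then interpret subharmonic_riesz G g g' b D u \<Delta>u
    by (intro subharmonic_riesz.intro subharmonic_riesz_axioms.intro assms)
  show ?thesis
    by (rule riesz_decomposition) fact+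
qed

end
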